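(* Let $\mathcal L$ be a recursively enumerable language over a finite alphabet. Then there exist a coverability language $\mathcal L'$ of some labelled marked RPN (with a finite set of final states), a regular language $\mathcal R$ and a homomorphism $h$ such that $\mathcal L=h(\mathcal L'\cap\mathcal R)$.
   Context: A Recursive Petri Net (RPN) is a tuple $\mathcal N=\langle P,T,W^+,W^-,\Omega\rangle$ where $P$ is a finite set of places, $T=T_{el}\uplus T_{ab}\uplus T_{\tau}$ is a finite set of transitions disjoint from $P$ (elementary, abstract and cut transitions), $W^-\in\mathbb N^{P\times T}$, $W^+\in\mathbb N^{P\times(T_{el}\uplus T_{ab})}$, and $\Omega:T_{ab}\to\mathbb N^P$. Write $W^{\pm}(t)\in\mathbb N^P$ for the column of $t$; markings are compared componentwise. A (concrete) state is either the empty tree $\emptyset$ or a finite rooted tree whose vertices (threads) are taken from a fixed countably infinite set $\mathcal V$, each vertex $v$ labelled by a marking $M_s(v)\in\mathbb N^P$ and each edge labelled by a vector in $\{W^+(t):t\in T_{ab}\}$. Firing rule: a thread $v$ of a state $s\neq\emptyset$ can fire $t$ if $W^-(t)\le M_s(v)$, giving $s\xrightarrow{(v,t)}s'$ where: if $t\in T_{el}$, the marking of $v$ becomes $M_s(v)-W^-(t)+W^+(t)$; if $t\in T_{ab}$, the marking of $v$ becomes $M_s(v)-W^-(t)$ and a new child $w$ of $v$ (a vertex never used before) is created with marking $\Omega(t)$ and edge $v\to w$ labelled $W^+(t)$; if $t\in T_\tau$, the subtree rooted at $v$ is deleted, and if $v$ is the root the result is $\emptyset$, otherwise the marking of the parent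 $u$ of $v$ is increased by the label of the edge $u\to v$. Quasi-order on states: $\emptyset\preceq s$ for every $s$; for $s\neq\emptyset$, $s\preceq s'$ iff there is an injective map $f$ from the vertices of $s$ to those of $s'$ with $M_s(v)\le M_{s'}(f(v))$ for all $v$ and, for every edge $v\to w$ of $s$ labelled $m$, an edge $f(v)\to f(w)$ of $s'$ labelled $m'\ge m$. A labelled RPN has a labelling $\lambda:T\to\Sigma\cup\{\varepsilon\}$ ($\Sigma$ finite), extended morphically to sequences; its coverability language for initial state $s_0$ and finite set of states $S_f$ is $\mathcal L_C(\mathcal N,s_0,S_f)=\{\lambda(\sigma)\mid s_0\xrightarrow{\sigma}s,\ s_f\preceq s\text{ for some }s_f\in S_f\}$. *)

theory Defs
  imports Main
begin

section \<open>Recursive Petri nets\<close>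

type_synonym 'p marking = "'p \<Rightarrow> nat"

text \<open>Vectors of naturals indexed by a set \<open>P\<close> are functions vanishing outside \<open>P\<close>, so that
  the pointwise order on functions is the componentwise order.\<close>

definition markings :: "'p set \<Rightarrow> 'p marking set" where
  "markings P = {m. \<forall>p. p \<notin> P \<longrightarrow> m p = 0}"

text \<open>Places and transitions live in different types, hence are disjoint. The values of
  \<open>W_plus\<close> outside \<open>T_el \<union> T_ab\<close> and of \<open>Omega\<close> outside \<open>T_ab\<close> are never used.\<close>

record ('p, 't) rpn =
  places :: "'p set"
  T_el :: "'t set"
  T_ab :: "'t set"
  T_tau :: "'t set"
  W_plus :: "'t \<Rightarrow> 'p marking"
  W_minus :: "'t \<Rightarrow> 'p marking"
  Omega :: "'t \<Rightarrow> 'p marking"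

definition transitions :: "('p, 't) rpn \<Rightarrow> 't set" where
  "transitions N = T_el N \<union> T_ab N \<union> T_tau N"

definition is_rpn :: "('p, 't) rpn \<Rightarrow> bool" where
  "is_rpn N \<longleftrightarrow>
     finite (places N) \<and> finite (transitions N) \<and>
     T_el N \<inter> T_ab N = {} \<and> T_el N \<inter> T_tau N = {} \<and> T_ab N \<inter> T_tau N = {} \<and>
     (\<forall>t \<in> transitions N. W_minus N t \<in> markings (places N)) \<and>
     (\<forall>t \<in> T_el N \<union> T_ab N. W_plus N t \<in> markings (places N)) \<and>
     (\<forall>t \<in> T_ab N. Omega N t \<in> markings (places N))"

text \<open>Vertices are taken from the countably infinite set of natural numbers. An edge
  \<open>(u, m, w)\<close> goes from the parent \<open>u\<close> to the child \<open>w\<close> and is labelled by \<open>m\<close>. The state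
  without vertices is the empty tree; markings of non-vertices are irrelevant.\<close>

type_synonym vertex = nat

record 'p state =
  verts :: "vertex set"
  mark :: "vertex \<Rightarrow> 'p marking"
  edges :: "(vertex \<times> 'p marking \<times> vertex) set"

definition empty_state :: "'p state" where
  "empty_state = \<lparr>verts = {}, mark = (\<lambda>_ _. 0), edges = {}\<rparr>"

definition child_rel :: "'p state \<Rightarrow> (vertex \<times> vertex) set" where
  "child_rel s = {(u, w). \<exists>m. (u, m, w) \<in> edges s}"

definition subtree_verts :: "'p state \<Rightarrow> vertex \<Rightarrow> vertex set" where
  "subtree_verts s v = {w. (v, w) \<in> (child_rel s)\<^sup>*}"

definition is_root :: "'p state \<Rightarrow> vertex \<Rightarrow> bool" where
  "is_root s r \<longleftrightarrow> r \<in> verts s \<and> (\<forall>u m. (u, m, r) \<notin> edges s)"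

definition finite_rooted_tree :: "'p state \<Rightarrow> bool" where
  "finite_rooted_tree s \<longleftrightarrow>
     finite (verts s) \<and> child_rel s \<subseteq> verts s \<times> verts s \<and>
     (\<exists>r. is_root s r \<and>
        (\<forall>w \<in> verts s - {r}. \<exists>!(u, m). (u, m, w) \<in> edges s) \<and>
        (\<forall>w \<in> verts s. w \<in> subtree_verts s r))"

definition is_state :: "('p, 't) rpn \<Rightarrow> 'p state \<Rightarrow> bool" where
  "is_state N s \<longleftrightarrow>
     (verts s = {} \<and> edges s = {}) \<or>
     (finite_rooted_tree s \<and>
      (\<forall>v \<in> verts s. mark s v \<in> markings (places N)) \<and>
      (\<forall>(u, m, w) \<in> edges s. m \<in> W_plus N ` T_ab N))"

definition delete_subtree :: "'p state \<Rightarrow> vertex \<Rightarrow> 'p state" where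
  "delete_subtree s v =
     s\<lparr>verts := verts s - subtree_verts s v,
       edges := {(u, m, w) \<in> edges s. u \<notin> subtree_verts s v \<and> w \<notin> subtree_verts s v}\<rparr>"

text \<open>The set \<open>U\<close> collects the vertices used so far in a run; a new thread gets a vertex
  outside \<open>U\<close>.\<close>

inductive fire ::
    "('p, 't) rpn \<Rightarrow> vertex set \<Rightarrow> 'p state \<Rightarrow> vertex \<times> 't \<Rightarrow> 'p state \<Rightarrow> bool"
  for N U s where
  elementary:
    "\<lbrakk>v \<in> verts s; t \<in> T_el N; W_minus N t \<le> mark s v\<rbrakk> \<Longrightarrow>
     fire N U s (v, t)
       (s\<lparr>mark := (mark s)(v := (\<lambda>p. mark s v p - W_minus N t p + W_plus N t p))\<rparr>)"
| abstract:
    "\<lbrakk>v \<in> verts s; t \<in> T_ab N; W_minus N t \<le> mark s v; w \<notin> U\<rbrakk> \<Longrightarrow>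
     fire N U s (v, t)
       \<lparr>verts = insert w (verts s),
        mark = (mark s)(v := (\<lambda>p. mark s v p - W_minus N t p), w := Omega N t),
        edges = insert (v, W_plus N t, w) (edges s)\<rparr>"
| cut_root:
    "\<lbrakk>t \<in> T_tau N; W_minus N t \<le> mark s v; is_root s v\<rbrakk> \<Longrightarrow>
     fire N U s (v, t) empty_state"
| cut_child:
    "\<lbrakk>v \<in> verts s; t \<in> T_tau N; W_minus N t \<le> mark s v; (u, m, v) \<in> edges s\<rbrakk> \<Longrightarrow>
     fire N U s (v, t)
       ((delete_subtree s v)\<lparr>mark := (mark s)(u := (\<lambda>p. mark s u p + m p))\<rparr>)"

inductive run ::
    "('p, 't) rpn \<Rightarrow> vertex set \<Rightarrow> 'p state \<Rightarrow> (vertex \<times> 't) list \<Rightarrow> 'p state \<Rightarrow> bool"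
  for N where
  run_Nil: "run N U s [] s"
| run_Cons: "\<lbrakk>fire N U s a s'; run N (U \<union> verts s') s' \<sigma> s''\<rbrakk> \<Longrightarrow> run N U s (a # \<sigma>) s''"

definition firing_sequence ::
    "('p, 't) rpn \<Rightarrow> 'p state \<Rightarrow> (vertex \<times> 't) list \<Rightarrow> 'p state \<Rightarrow> bool" where
  "firing_sequence N s \<sigma> s' \<longleftrightarrow> run N (verts s) s \<sigma> s'"

definition state_le :: "'p state \<Rightarrow> 'p state \<Rightarrow> bool" (infix "\<preceq>" 50) where
  "s \<preceq> s' \<longleftrightarrow>
     verts s = {} \<or>
     (\<exists>f. inj_on f (verts s) \<and> f ` verts s \<subseteq> verts s' \<and>
        (\<forall>v \<in> verts s. mark s v \<le> mark s' (f v)) \<and>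
        (\<forall>(v, m, w) \<in> edges s. \<exists>m'. (f v, m', f w) \<in> edges s' \<and> m \<le> m'))"

text \<open>In a labelling, \<open>None\<close> stands for the empty word.\<close>

definition is_labelling :: "('p, 't) rpn \<Rightarrow> 'b set \<Rightarrow> ('t \<Rightarrow> 'b option) \<Rightarrow> bool" where
  "is_labelling N A lab \<longleftrightarrow> (\<forall>t \<in> transitions N. lab t \<in> insert None (Some ` A))"

definition label_word :: "('t \<Rightarrow> 'b option) \<Rightarrow> (vertex \<times> 't) list \<Rightarrow> 'b list" where
  "label_word lab \<sigma> =
     concat (map (\<lambda>(v, t). case lab t of None \<Rightarrow> [] | Some a \<Rightarrow> [a]) \<sigma>)"

definition cov_lang ::
    "('p, 't) rpn \<Rightarrow> ('t \<Rightarrow> 'b option) \<Rightarrow> 'p state \<Rightarrow> 'p state set \<Rightarrow> 'b list set" where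
  "cov_lang N lab s0 Sf =
     {label_word lab \<sigma> | \<sigma> s. firing_sequence N s0 \<sigma> s \<and> (\<exists>sf \<in> Sf. sf \<preceq> s)}"

text \<open>Finitely many places and transitions can always be named by natural numbers.\<close>

definition rpn_coverability_language :: "'b set \<Rightarrow> 'b list set \<Rightarrow> bool" where
  "rpn_coverability_language A L \<longleftrightarrow>
     finite A \<and>
     (\<exists>(N :: (nat, nat) rpn) lab s0 Sf.
        is_rpn N \<and> is_labelling N A lab \<and>
        is_state N s0 \<and> finite Sf \<and> (\<forall>sf \<in> Sf. is_state N sf) \<and>
        L = cov_lang N lab s0 Sf)"


section \<open>Regular languages and homomorphisms\<close>

record ('q, 'b) fa =
  fa_states :: "'q set"
  fa_init :: "'q set"
  fa_trans :: "('q \<times> 'b \<times> 'q) set"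
  fa_final :: "'q set"

definition is_fa :: "'b set \<Rightarrow> ('q, 'b) fa \<Rightarrow> bool" where
  "is_fa A M \<longleftrightarrow>
     finite A \<and> finite (fa_states M) \<and>
     fa_init M \<subseteq> fa_states M \<and> fa_final M \<subseteq> fa_states M \<and>
     fa_trans M \<subseteq> fa_states M \<times> A \<times> fa_states M"

inductive fa_path :: "('q, 'b) fa \<Rightarrow> 'q \<Rightarrow> 'b list \<Rightarrow> 'q \<Rightarrow> bool" for M where
  "fa_path M q [] q"
| "\<lbrakk>(q, a, q') \<in> fa_trans M; fa_path M q' w q''\<rbrakk> \<Longrightarrow> fa_path M q (a # w) q''"

definition fa_lang :: "('q, 'b) fa \<Rightarrow> 'b list set" where
  "fa_lang M = {w. \<exists>q \<in> fa_init M. \<exists>q' \<in> fa_final M. fa_path M q w q'}"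

definition regular_language :: "'b set \<Rightarrow> 'b list set \<Rightarrow> bool" where
  "regular_language A L \<longleftrightarrow> (\<exists>M :: (nat, 'b) fa. is_fa A M \<and> L = fa_lang M)"

definition word_homomorphism :: "'b set \<Rightarrow> 'a set \<Rightarrow> ('b list \<Rightarrow> 'a list) \<Rightarrow> bool" where
  "word_homomorphism A B h \<longleftrightarrow>
     h ` lists A \<subseteq> lists B \<and> h [] = [] \<and>
     (\<forall>u \<in> lists A. \<forall>v \<in> lists A. h (u @ v) = h u @ h v)"


section \<open>Recursively enumerable languages\<close>

text \<open>Deterministic Turing machines with one two-way infinite tape, accepting by entering
  an accepting state.\<close>

datatype direction = Left | Right

record ('q, 'g) tm =
  tm_states :: "'q set"
  tm_input :: "'g set"
  tm_tape :: "'g set"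
  tm_blank :: "'g"
  tm_delta :: "'q \<Rightarrow> 'g \<Rightarrow> ('q \<times> 'g \<times> direction) option"
  tm_start :: "'q"
  tm_accept :: "'q set"

definition is_tm :: "('q, 'g) tm \<Rightarrow> bool" where
  "is_tm M \<longleftrightarrow>
     finite (tm_states M) \<and> finite (tm_tape M) \<and>
     tm_input M \<subseteq> tm_tape M \<and> tm_blank M \<in> tm_tape M - tm_input M \<and>
     tm_start M \<in> tm_states M \<and> tm_accept M \<subseteq> tm_states M \<and>
     (\<forall>q \<in> tm_states M. \<forall>x \<in> tm_tape M. \<forall>q' y d.
        tm_delta M q x = Some (q', y, d) \<longrightarrow> q' \<in> tm_states M \<and> y \<in> tm_tape M)"

type_synonym ('q, 'g) config = "'q \<times> (int \<Rightarrow> 'g) \<times> int"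

fun move_head :: "direction \<Rightarrow> int \<Rightarrow> int" where
  "move_head Left i = i - 1"
| "move_head Right i = i + 1"

inductive tm_step :: "('q, 'g) tm \<Rightarrow> ('q, 'g) config \<Rightarrow> ('q, 'g) config \<Rightarrow> bool" for M where
  "tm_delta M q (tape i) = Some (q', y, d) \<Longrightarrow>
   tm_step M (q, tape, i) (q', tape(i := y), move_head d i)"

definition tm_initial :: "('q, 'g) tm \<Rightarrow> 'g list \<Rightarrow> ('q, 'g) config" where
  "tm_initial M w =
     (tm_start M, (\<lambda>i. if 0 \<le> i \<and> i < int (length w) then w ! nat i else tm_blank M), 0)"

definition tm_accepts :: "('q, 'g) tm \<Rightarrow> 'g list \<Rightarrow> bool" where
  "tm_accepts M w \<longleftrightarrow>
     (\<exists>q tape i. (tm_step M)\<^sup>*\<^sup>* (tm_initial M w) (q, tape, i) \<and> q \<in> tm_accept M)"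

definition tm_lang :: "('q, 'g) tm \<Rightarrow> 'g list set" where
  "tm_lang M = {w \<in> lists (tm_input M). tm_accepts M w}"

text \<open>The tape alphabet consists of letters \<open>Inl a\<close> and auxiliary symbols \<open>Inr k\<close>, among
  which the blank; the type provides as many auxiliary symbols as needed.\<close>

definition recursively_enumerable :: "'a set \<Rightarrow> 'a list set \<Rightarrow> bool" where
  "recursively_enumerable A L \<longleftrightarrow>
     L \<subseteq> lists A \<and>
     (\<exists>M :: (nat, 'a + nat) tm. is_tm M \<and> tm_input M = Inl ` A \<and> map Inl ` L = tm_lang M)"

end

theory Submission
  imports Defs
begin

text \<open>
  The root of an RPN state can carry two independent chains of threads, which behave like two
  stacks: an abstract transition pushes a symbol and a cut transition pops one, and only the last
  thread of each chain is active. Giving every transition its own label and accepting every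
  reachable state, the coverability language consists of all words of stack operations that can
  be executed from empty stacks. A finite automaton reading these words plays the role of the
  control of a Turing machine whose tape is held by the two stacks. The automaton first guesses
  enough blanks and the input word, and the homomorphism erases everything but the operations that
  push the input.
\<close>

section \<open>Automata with word-labelled edges\<close>

text \<open>A net transition fires in a single thread, so the net alone cannot coordinate the two
  stacks; the regular language does that by fixing how their operations interleave. The automaton in
  turn cannot see the stacks. It reads a cell by guessing the symbol in the label of a pop, and
  after a wrong guess the net has no such firing. Every error therefore yields a word outside the
  intersection, never a false acceptance. No operation tests a stack for emptiness, so blanks cannot
  be supplied at the moment when one half of the tape runs out; they have to be there before the
  simulation starts. A finite computation needs only finitely many, and a guess that is too small
  merely blocks. The input is guessed as well, because the homomorphism must recover it from the
  word itself. Pushing it leaves it reversed on the left stack; moving it to the right stack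
  restores its order and leaves the head at its beginning.\<close>

lemma regular_language_fa_lang:
  fixes M :: "('q, 'b) fa"
  assumes M: "is_fa A M"
  shows "regular_language A (fa_lang M)"
proof -
  have fin: "finite (fa_states M)" using M by (simp add: is_fa_def)
  then obtain f :: "'q \<Rightarrow> nat" where f: "inj_on f (fa_states M)"
    using finite_imp_inj_to_nat_seg by blast
  have init: "fa_init M \<subseteq> fa_states M" and final: "fa_final M \<subseteq> fa_states M"
    and trans: "fa_trans M \<subseteq> fa_states M \<times> A \<times> fa_states M"
    using M by (auto simp: is_fa_def)
  define M' where "M' = \<lparr>fa_states = f ` fa_states M, fa_init = f ` fa_init M,
    fa_trans = (\<lambda>(p, a, q). (f p, a, f q)) ` fa_trans M, fa_final = f ` fa_final M\<rparr>"
  have "is_fa A M'"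
    using M fin init final trans by (fastforce simp: is_fa_def M'_def)
  moreover have fwd: "fa_path M' (f q) w (f q')" if "fa_path M q w q'" for q w q'
    using that by induction (force intro: fa_path.intros simp: M'_def)+
  \<comment> \<open>Injectivity of \<open>f\<close> is available on \<open>fa_states M\<close> only,
    so lifting a path back has to carry along that each state reached comes from there.\<close>
  have bwd: "\<exists>q' \<in> fa_states M. p' = f q' \<and> fa_path M q w q'"
    if "fa_path M' p w p'" "p = f q" "q \<in> fa_states M" for p w p' q
    using that
  proof (induction arbitrary: q)
    case (1 p)
    then show ?case using fa_path.intros(1) by fast
  next
    case (2 p a p1 w p2)
    then obtain r r' where r: "(r, a, r') \<in> fa_trans M" "p = f r" "p1 = f r'"
      by (auto simp: M'_def)
    with 2 trans f have "r = q" "r' \<in> fa_states M" by (auto simp: inj_on_def)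
    with 2 r show ?case using fa_path.intros(2) by metis
  qed
  have "fa_lang M = fa_lang M'"
  proof (intro equalityI subsetI)
    fix w assume "w \<in> fa_lang M"
    then show "w \<in> fa_lang M'" using fwd by (fastforce simp: fa_lang_def M'_def)
  next
    fix w assume "w \<in> fa_lang M'"
    then obtain q q' where q: "q \<in> fa_init M" "q' \<in> fa_final M" "fa_path M' (f q) w (f q')"
      by (auto simp: fa_lang_def M'_def)
    with bwd init obtain q'' where "q'' \<in> fa_states M" "f q' = f q''" "fa_path M q w q''" by blast
    moreover from this q final f have "q'' = q'" by (auto simp: inj_on_def)
    ultimately show "w \<in> fa_lang M" using q by (auto simp: fa_lang_def)
  qed
  ultimately show ?thesis unfolding regular_language_def by blast
qed

text \<open>Whole words on edges make one Turing machine move, a sequence of stack operations, a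
  single edge; no intermediate controls need names.\<close>

inductive word_path :: "('q \<times> 'b list \<times> 'q) set \<Rightarrow> 'q \<Rightarrow> 'b list \<Rightarrow> 'q \<Rightarrow> bool" for E where
  word_path_Nil: "word_path E q [] q"
| word_path_step: "\<lbrakk>(p, u, q) \<in> E; word_path E q w r\<rbrakk> \<Longrightarrow> word_path E p (u @ w) r"

lemma word_path_append:
  "\<lbrakk>word_path E p u q; word_path E q v r\<rbrakk> \<Longrightarrow> word_path E p (u @ v) r"
  by (induction rule: word_path.induct) (auto intro: word_path.intros)

lemma word_path_single: "(p, u, q) \<in> E \<Longrightarrow> word_path E p u q"
  using word_path_step[OF _ word_path_Nil, of p u q E] by simp

text \<open>A state \<open>(v, q)\<close> of the automaton means that \<open>v\<close> has still to be read before \<open>q\<close> is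
  reached.\<close>

lemma regular_language_word_path:
  fixes E :: "('q \<times> 'b list \<times> 'q) set"
  assumes "finite A" and "finite E" and "finite F"
    and E: "\<And>p u q. (p, u, q) \<in> E \<Longrightarrow> u \<in> lists A \<and> u \<noteq> []"
  shows "regular_language A {w. \<exists>q \<in> F. word_path E q0 w q}"
proof -
  define S where "S = Pair [] ` insert q0 F \<union>
    (\<Union>(p, u, q) \<in> E. (\<lambda>k. (drop k u, q)) ` {..length u})"
  \<comment> \<open>The second set leaves \<open>([], p)\<close> by reading the first letter of an
    edge label at once, which avoids silent moves; here labels must be non-empty.\<close>
  define T where "T = {((a # v, q), a, (v, q)) | a v q. True} \<union>
    {(([], p), a, (v, q)) | p a v q. (p, a # v, q) \<in> E}"
  \<comment> \<open>\<open>T\<close> ranges over all pending words; intersecting it with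
    \<open>S \<times> A \<times> S\<close> makes the automaton finite.\<close>
  define M where "M = \<lparr>fa_states = S, fa_init = {([], q0)},
    fa_trans = T \<inter> S \<times> A \<times> S, fa_final = Pair [] ` F\<rparr>"
  have "finite S" using assms by (auto simp: S_def)
  then have fa: "is_fa A M"
    using assms by (auto simp: is_fa_def M_def S_def)
  have S_tl: "a \<in> A \<and> (v, q) \<in> S" if "(a # v, q) \<in> S" for a v q
  proof -
    from that obtain p u k where u: "(p, u, q) \<in> E" "a # v = drop k u"
      by (auto simp: S_def)
    then have "k < length u" by (metis drop_all linorder_not_less list.distinct(1))
    moreover from u have "v = drop (Suc k) u" by (metis drop_Suc list.sel(3) tl_drop)
    moreover have "a \<in> set u" using u by (metis in_set_dropD list.set_intros(1))
    ultimately show ?thesis using u E unfolding S_def by (force simp: lists_eq_set)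
  qed
  have S_E: "(u, q) \<in> S" "([], q) \<in> S" if "(p, u, q) \<in> E" for p u q
  proof -
    show "(u, q) \<in> S" using that unfolding S_def by (force intro: image_eqI[of _ _ 0])
    then show "([], q) \<in> S" by (induction u) (use S_tl in auto)
  qed
  have fwd: "fa_path M (v, q) (v @ w) y" if "fa_path M ([], q) w y" "(v, q) \<in> S" for v q w y
    using that(2)
  proof (induction v)
    case Nil
    then show ?case using that(1) by simp
  next
    case (Cons a v)
    with S_tl have "((a # v, q), a, (v, q)) \<in> fa_trans M"
      by (auto simp: M_def T_def)
    with Cons S_tl show ?case using fa_path.intros(2) by fastforce
  qed
  have comp: "fa_path M ([], p) w ([], q)" if "word_path E p w q" "([], p) \<in> S" for p w q
    using that
  proof (induction)
    case (word_path_Nil q)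
    show ?case by (rule fa_path.intros)
  next
    case (word_path_step p u q w r)
    then obtain a v where u: "u = a # v" using E by (meson neq_Nil_conv)
    with word_path_step S_E S_tl have "(([], p), a, (v, q)) \<in> fa_trans M"
      by (fastforce simp: M_def T_def)
    moreover have "fa_path M (v, q) (v @ w) ([], r)"
      using word_path_step S_E S_tl u by (intro fwd) blast+
    ultimately show ?case using u fa_path.intros(2) by fastforce
  qed
  \<comment> \<open>The path may start with any pending word, since the first letter of an edge
    label already leads to such a state.\<close>
  have sound: "\<exists>w'. w = fst x @ w' \<and> word_path E (snd x) w' (snd y)"
    if "fa_path M x w y" "fst y = []" for x w y
    using that
  proof (induction)
    case (1 q)
    then show ?case by (auto intro: word_path.intros)
  next
    case (2 x a x' w y)
    then obtain w' where w': "w = fst x' @ w'" "word_path E (snd x') w' (snd y)" by auto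
    from 2 have "(x, a, x') \<in> T" by (simp add: M_def)
    then consider (inner) v q where "x = (a # v, q)" "x' = (v, q)"
      | (new) p v q where "x = ([], p)" "x' = (v, q)" "(p, a # v, q) \<in> E"
      by (auto simp: T_def)
    then show ?case
    proof cases
      case inner
      then show ?thesis using w' by auto
    next
      case new
      then have "word_path E p ((a # v) @ w') (snd y)"
        using w' by (intro word_path_step) auto
      then show ?thesis using new w' by auto
    qed
  qed
  have "([], q0) \<in> S" by (simp add: S_def)
  then have "fa_lang M = {w. \<exists>q \<in> F. word_path E q0 w q}"
    using comp sound by (fastforce simp: fa_lang_def M_def)
  then show ?thesis using regular_language_fa_lang[OF fa] by simp
qed

section \<open>Two stacks as a recursive Petri net\<close>

type_synonym stacks = "bool \<Rightarrow> nat list"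

text \<open>Two stacks over the even and the odd symbols, respectively: the operation \<open>2 * c\<close> pushes
  \<open>c\<close> and \<open>2 * c + 1\<close> pops \<open>c\<close>, on the stack given by the parity of \<open>c\<close>.\<close>

definition exec_op :: "nat \<Rightarrow> stacks \<Rightarrow> stacks option" where
  "exec_op a st = (let c = a div 2; i = odd c in
     if even a then Some (st(i := c # st i))
     else if st i \<noteq> [] \<and> hd (st i) = c then Some (st(i := tl (st i))) else None)"

fun exec_ops :: "nat list \<Rightarrow> stacks \<Rightarrow> stacks option" where
  "exec_ops [] st = Some st"
| "exec_ops (a # u) st = Option.bind (exec_op a st) (exec_ops u)"

lemma exec_op_push [simp]: "exec_op (2 * c) st = Some (st(odd c := c # st (odd c)))"
  by (simp add: exec_op_def Let_def)

lemma exec_op_pop: "exec_op (Suc (2 * c)) st = Some st' \<longleftrightarrow>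
    (\<exists>r. st (odd c) = c # r \<and> st' = st(odd c := r))"
  by (cases "st (odd c)") (auto simp: exec_op_def Let_def)

lemma exec_ops_append: "exec_ops (u @ v) st = Option.bind (exec_ops u st) (exec_ops v)"
proof (induction u arbitrary: st)
  case (Cons a u)
  then show ?case by (cases "exec_op a st") auto
qed simp

section \<open>Encoding two stacks in a marked tree\<close>

definition unit_marking :: "nat \<Rightarrow> nat marking" where
  "unit_marking p = (\<lambda>x. of_bool (x = p))"

text \<open>The same vector is the marking given to a pushed thread and the one demanded by the cut
  that pops it.\<close>

definition cell_marking :: "nat \<Rightarrow> nat marking" where
  "cell_marking c = (\<lambda>x. of_bool (x = of_bool (odd c) \<or> x = c + 2))"

text \<open>A token in place \<open>0\<close> or \<open>1\<close> marks the thread at the top of the even or odd stack, and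
  a token in place \<open>c + 2\<close> says that the thread stores \<open>c\<close>. Pushing takes the top token away
  from the parent, which gets it back as the edge label when the child is cut; hence only the
  thread at the top of a stack can act, and it has no children there.\<close>

definition stack_net :: "nat \<Rightarrow> (nat, nat) rpn" where
  "stack_net K = \<lparr>places = {..<K + 2}, T_el = {},
     T_ab = {t. t < 2 * K \<and> even t}, T_tau = {t. t < 2 * K \<and> odd t},
     W_plus = (\<lambda>t. unit_marking (of_bool (odd (t div 2)))),
     W_minus = (\<lambda>t. if even t then unit_marking (of_bool (odd (t div 2)))
                    else cell_marking (t div 2)),
     Omega = (\<lambda>t. cell_marking (t div 2))\<rparr>"

text \<open>The root is the top of both empty stacks, hence holds both activity tokens. It has no
  token in any place \<open>c + 2\<close>, so no cut is enabled there.\<close>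

definition stack_init :: "nat state" where
  "stack_init = \<lparr>verts = {0}, mark = (\<lambda>_ p. of_bool (p < 2)), edges = {}\<rparr>"

definition top_vertex :: "(vertex \<times> nat) list \<Rightarrow> vertex" where
  "top_vertex z = (case z of [] \<Rightarrow> 0 | x # _ \<Rightarrow> fst x)"

fun chain_edges :: "bool \<Rightarrow> (vertex \<times> nat) list \<Rightarrow> (vertex \<times> nat marking \<times> vertex) set" where
  "chain_edges i [] = {}"
| "chain_edges i (x # z) =
     insert (top_vertex z, unit_marking (of_bool i), fst x) (chain_edges i z)"

text \<open>The root \<open>0\<close> is the common bottom of both stacks; \<open>z i\<close> lists, from the top down, the
  threads of stack \<open>i\<close> with the symbols they store.\<close>

definition represents :: "nat state \<Rightarrow> (bool \<Rightarrow> (vertex \<times> nat) list) \<Rightarrow> bool" where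
  "represents s z \<longleftrightarrow>
     (\<forall>i. distinct (map fst (z i)) \<and> 0 \<notin> fst ` set (z i)) \<and>
     fst ` set (z False) \<inter> fst ` set (z True) = {} \<and>
     verts s = insert 0 (\<Union>i. fst ` set (z i)) \<and>
     edges s = (\<Union>i. chain_edges i (z i)) \<and>
     (\<forall>i v c p. (v, c) \<in> set (z i) \<longrightarrow> mark s v (p + 2) = of_bool (p = c)) \<and>
     (\<forall>p. mark s 0 (p + 2) = 0) \<and>
     (\<forall>i. \<forall>v \<in> verts s. mark s v (of_bool i) = of_bool (v = top_vertex (z i)))"

lemma
  assumes "represents s z"
  shows represents_verts: "verts s = insert 0 (\<Union>i. fst ` set (z i))"
    and represents_edges: "edges s = (\<Union>i. chain_edges i (z i))"
    and represents_cell: "(v, c) \<in> set (z i) \<Longrightarrow> mark s v (p + 2) = of_bool (p = c)"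
    and represents_root: "mark s 0 (p + 2) = 0"
    and represents_top: "v \<in> verts s \<Longrightarrow> mark s v (of_bool i) = of_bool (v = top_vertex (z i))"
    and represents_distinct: "distinct (map fst (z i))" "0 \<notin> fst ` set (z i)"
    and represents_disjoint: "fst ` set (z False) \<inter> fst ` set (z True) = {}"
proof -
  note rep = assms[unfolded represents_def]
  show "verts s = insert 0 (\<Union>i. fst ` set (z i))" using rep by (elim conjE)
  show "edges s = (\<Union>i. chain_edges i (z i))" using rep by (elim conjE)
  show "(v, c) \<in> set (z i) \<Longrightarrow> mark s v (p + 2) = of_bool (p = c)" using rep by (elim conjE) metis
  show "mark s 0 (p + 2) = 0" using rep by (elim conjE) metis
  show "v \<in> verts s \<Longrightarrow> mark s v (of_bool i) = of_bool (v = top_vertex (z i))"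
    using rep by (elim conjE) metis
  show "distinct (map fst (z i))" "0 \<notin> fst ` set (z i)" using rep by (elim conjE, metis)+
  show "fst ` set (z False) \<inter> fst ` set (z True) = {}" using rep by (elim conjE)
qed

lemma top_vertex_in: "top_vertex z \<in> insert 0 (fst ` set z)"
  by (cases z) (auto simp: top_vertex_def)

text \<open>The \<open>tl\<close> is the point: with distinct vertices other than the root, the head
  of \<open>z\<close> is the source of no edge, so the top thread is a leaf.\<close>

lemma chain_edges_source:
  "(u, m, w) \<in> chain_edges i z \<Longrightarrow> u \<in> insert 0 (fst ` set (tl z))"
proof (induction z)
  case (Cons x z)
  have "set (tl z) \<subseteq> set z" by (cases z) auto
  then have "insert 0 (fst ` set (tl z)) \<subseteq> insert 0 (fst ` set z)" by blast
  moreover have "u = top_vertex z \<or> (u, m, w) \<in> chain_edges i z" using Cons.prems by auto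
  ultimately show ?case using Cons.IH top_vertex_in[of z] by (metis list.sel(3) subsetD)
qed simp

lemma chain_edges_target: "(u, m, w) \<in> chain_edges i z \<Longrightarrow> w \<in> fst ` set z"
  by (induction z) auto

lemma top_vertex_in_verts: "represents s z \<Longrightarrow> top_vertex (z i) \<in> verts s"
  using top_vertex_in[of "z i"] by (auto simp: represents_verts)

lemma of_bool_neq_add2 [simp]: "(of_bool i :: nat) \<noteq> p + 2" "(of_bool i :: nat) \<noteq> Suc (Suc p)"
  "Suc (Suc p) \<noteq> of_bool i"
  by (cases i; auto)+

lemma represents_init: "represents stack_init (\<lambda>_. [])"
  by (auto simp: represents_def stack_init_def top_vertex_def)

lemma unit_marking_le_iff:
  assumes "represents s z" "v \<in> verts s"
  shows "unit_marking (of_bool i) \<le> mark s v \<longleftrightarrow> v = top_vertex (z i)"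
proof -
  have "unit_marking (of_bool i) \<le> mark s v \<longleftrightarrow> 1 \<le> mark s v (of_bool i)"
    by (auto simp: unit_marking_def le_fun_def)
  then show ?thesis by (simp add: represents_top[OF assms])
qed

text \<open>Why a cut is a pop: the token in place \<open>of_bool (odd c)\<close> forces
  \<open>v\<close> to be the top, the one in place \<open>c + 2\<close> fixes its symbol, and the
  root fails the second test, so an empty stack cannot be popped.\<close>

lemma cell_marking_le_iff:
  assumes rep: "represents s z" and v: "v \<in> verts s"
  shows "cell_marking c \<le> mark s v \<longleftrightarrow> (\<exists>r. z (odd c) = (v, c) # r)"
proof -
  have "cell_marking c \<le> mark s v \<longleftrightarrow> 1 \<le> mark s v (of_bool (odd c)) \<and> 1 \<le> mark s v (c + 2)"
  proof
    assume le: "cell_marking c \<le> mark s v"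
    show "1 \<le> mark s v (of_bool (odd c)) \<and> 1 \<le> mark s v (c + 2)"
      using le_funD[OF le, of "of_bool (odd c)"] le_funD[OF le, of "c + 2"]
      by (simp add: cell_marking_def)
  next
    assume m: "1 \<le> mark s v (of_bool (odd c)) \<and> 1 \<le> mark s v (c + 2)"
    show "cell_marking c \<le> mark s v"
    proof (rule le_funI)
      fix x show "cell_marking c x \<le> mark s v x"
        using m by (cases "x = of_bool (odd c) \<or> x = c + 2") (auto simp: cell_marking_def)
    qed
  qed
  also have "1 \<le> mark s v (of_bool (odd c)) \<longleftrightarrow> v = top_vertex (z (odd c))"
    by (simp add: represents_top[OF rep v])
  also have "v = top_vertex (z (odd c)) \<and> 1 \<le> mark s v (c + 2) \<longleftrightarrow> (\<exists>r. z (odd c) = (v, c) # r)"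
  proof (cases "z (odd c)")
    case Nil
    then show ?thesis using represents_root[OF rep, of c] by (auto simp: top_vertex_def)
  next
    case (Cons x r)
    then have "mark s (fst x) (c + 2) = of_bool (c = snd x)"
      by (intro represents_cell[OF rep, of _ _ "odd c"]) simp
    with Cons show ?thesis by (cases x; cases "c = snd x") (auto simp: top_vertex_def)
  qed
  finally show ?thesis .
qed

section \<open>Push and pop as changes of the tree\<close>

text \<open>Vertices and edges are both unions over the two stacks, and a push or a pop changes one
  member of the union by a single element.\<close>

lemma UN_fun_upd_insert:
  assumes "f i y = insert x (f i (z i))"
  shows "(\<Union>j. f j ((z(i := y)) j)) = insert x (\<Union>j. f j (z j))"
  using assms by (auto split: if_splits)

text \<open>The activity token passes from the old top to the fresh thread. The other stack keeps
  its top even if both tops are the root, because its token lies in the other place.\<close>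

lemma represents_push:
  assumes rep: "represents s z" and w: "w \<notin> verts s" and v: "v = top_vertex (z (odd c))"
  shows "represents \<lparr>verts = insert w (verts s),
      mark = (mark s)(v := (\<lambda>p. mark s v p - unit_marking (of_bool (odd c)) p), w := cell_marking c),
      edges = insert (v, unit_marking (of_bool (odd c)), w) (edges s)\<rparr>
    (z(odd c := (w, c) # z (odd c)))" (is "represents ?s ?z")
proof -
  have in_verts: "u \<in> verts s" if "(u, d) \<in> set (z i)" for u d i
    using that represents_verts[OF rep] by force
  have zero: "0 \<in> verts s" by (simp add: represents_verts[OF rep])
  have wz: "w \<notin> fst ` set (z i)" for i using w represents_verts[OF rep] by auto
  have mark_cell: "mark ?s u (p + 2) = mark s u (p + 2)" if "u \<in> verts s" for u p
    using that w by (auto simp: unit_marking_def)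
  have mark_top: "mark ?s u (of_bool i) = of_bool (u = top_vertex (?z i))" if "u \<in> verts ?s" for u i
  proof (cases "u = w")
    case True
    then show ?thesis
      using top_vertex_in_verts[OF rep, of i] w
      by (cases "i = odd c") (auto simp: cell_marking_def top_vertex_def)
  next
    case False
    with that have "u \<in> verts s" by simp
    then have "mark s u (of_bool i) = of_bool (u = top_vertex (z i))"
      by (rule represents_top[OF rep])
    then show ?thesis using False v by (auto simp: unit_marking_def top_vertex_def)
  qed
  show ?thesis unfolding represents_def
  proof (intro conjI allI ballI)
    fix i
    show "distinct (map fst (?z i))" "0 \<notin> fst ` set (?z i)"
      using represents_distinct[OF rep, of i] wz[of i] zero w by auto
  next
    show "fst ` set (?z False) \<inter> fst ` set (?z True) = {}"
      using represents_disjoint[OF rep] wz[of True] wz[of False] by (cases "odd c") auto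
  next
    show "verts ?s = insert 0 (\<Union>i. fst ` set (?z i))"
      using represents_verts[OF rep] UN_fun_upd_insert[of "\<lambda>_ y. fst ` set y" "odd c" "(w, c) # z (odd c)" w z]
      by (simp add: insert_commute)
  next
    show "edges ?s = (\<Union>i. chain_edges i (?z i))"
      using represents_edges[OF rep] v
        UN_fun_upd_insert[of chain_edges "odd c" "(w, c) # z (odd c)" "(v, unit_marking (of_bool (odd c)), w)" z]
      by simp
  next
    fix i u d p
    show "(u, d) \<in> set (?z i) \<longrightarrow> mark ?s u (p + 2) = of_bool (p = d)"
    proof (cases "(u, d) = (w, c)")
      case True
      then show ?thesis by (auto simp: cell_marking_def)
    next
      case False
      have "mark ?s u (p + 2) = of_bool (p = d)" if "(u, d) \<in> set (?z i)"
      proof -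
        from that False have "(u, d) \<in> set (z i)" by (auto split: if_splits)
        then show ?thesis
          using represents_cell[OF rep, of u d i p] mark_cell[OF in_verts, of u d i p] by (simp only:)
      qed
      then show ?thesis ..
    qed
  next
    fix p
    show "mark ?s 0 (p + 2) = 0" using mark_cell[OF zero] represents_root[OF rep] by simp
  next
    fix i u assume "u \<in> verts ?s"
    then show "mark ?s u (of_bool i) = of_bool (u = top_vertex (?z i))" by (rule mark_top)
  qed
qed

lemma represents_top_fresh:
  assumes rep: "represents s z" and z: "z i = (v, c) # r"
  shows "v \<noteq> 0" and "v \<notin> fst ` set r" and "j \<noteq> i \<Longrightarrow> v \<notin> fst ` set (z j)"
proof -
  show "v \<noteq> 0" and "v \<notin> fst ` set r" using represents_distinct[OF rep, of i] z by auto
  have "v \<in> fst ` set (z i)" using z by simp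
  then show "v \<notin> fst ` set (z j)" if "j \<noteq> i"
    using represents_disjoint[OF rep] that by (cases i; cases j) auto
qed

text \<open>A cut deletes a whole subtree, so a pop is faithful only at a leaf. Sources of edges are
  the root and threads strictly below the top of a chain; \<open>v\<close> is not the root, which
  may carry the other chain.\<close>

lemma subtree_verts_top:
  assumes rep: "represents s z" and z: "z i = (v, c) # r"
  shows "subtree_verts s v = {v}"
proof -
  have "(v, m, w) \<notin> edges s" for m w
  proof
    assume "(v, m, w) \<in> edges s"
    then obtain j where "(v, m, w) \<in> chain_edges j (z j)" unfolding represents_edges[OF rep] by blast
    then have v: "v \<in> insert 0 (fst ` set (tl (z j)))" by (rule chain_edges_source)
    have "v \<noteq> 0" and "v \<notin> fst ` set (tl (z i))"
      using represents_top_fresh[OF rep z] z by auto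
    moreover have "v \<notin> fst ` set (z j)" if "j \<noteq> i"
      using represents_top_fresh(3)[OF rep z that] .
    moreover have "set (tl (z j)) \<subseteq> set (z j)" by (cases "z j") auto
    ultimately show False using v by (cases "j = i") auto
  qed
  then have no_child: "(v, w) \<notin> child_rel s" for w by (auto simp: child_rel_def)
  have "w = v" if "(v, w) \<in> (child_rel s)\<^sup>*" for w
    using that by (cases rule: converse_rtranclE) (use no_child in auto)
  then show ?thesis unfolding subtree_verts_def by blast
qed

text \<open>Determines what a cut gives back and to whom: the activity token, to the thread just
  below. The existence of this edge also shows that \<open>v\<close> is not a root.\<close>

lemma edge_into_top:
  assumes rep: "represents s z" and z: "z i = (v, c) # r"
  shows "(u, m, v) \<in> edges s \<longleftrightarrow> u = top_vertex r \<and> m = unit_marking (of_bool i)"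
proof
  assume "(u, m, v) \<in> edges s"
  then obtain j where j: "(u, m, v) \<in> chain_edges j (z j)" unfolding represents_edges[OF rep] by blast
  then have "v \<in> fst ` set (z j)" by (rule chain_edges_target)
  then have "j = i" using represents_top_fresh(3)[OF rep z] by blast
  moreover have "v \<notin> fst ` set r" by (rule represents_top_fresh[OF rep z])
  ultimately show "u = top_vertex r \<and> m = unit_marking (of_bool i)"
    using j z chain_edges_target[of u m v i r] by auto
next
  assume "u = top_vertex r \<and> m = unit_marking (of_bool i)"
  then have "(u, m, v) \<in> chain_edges i (z i)" using z by simp
  then show "(u, m, v) \<in> edges s" unfolding represents_edges[OF rep] by blast
qed

lemma represents_pop:
  assumes rep: "represents s z" and z: "z i = (v, c) # r"
  shows "represents ((delete_subtree s v)\<lparr>mark :=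
      (mark s)(top_vertex r := (\<lambda>p. mark s (top_vertex r) p + unit_marking (of_bool i) p))\<rparr>)
    (z(i := r))" (is "represents ?s ?z")
proof -
  let ?u = "top_vertex r"
  note v_fresh = represents_top_fresh[OF rep z]
  have v_z: "v \<notin> fst ` set (?z j)" for j using v_fresh(2) v_fresh(3)[of j] by simp
  have verts: "verts ?s = verts s - {v}"
    by (simp add: delete_subtree_def subtree_verts_top[OF rep z])
  have edges: "edges ?s = {(u, m, w) \<in> edges s. u \<noteq> v \<and> w \<noteq> v}"
    by (simp add: delete_subtree_def subtree_verts_top[OF rep z])
  \<comment> \<open>The insertion lemma is used in reverse: the popped family \<open>?z\<close> is
    the smaller one, and writing \<open>z i\<close> back into it gives \<open>z\<close>.\<close>
  have restore: "?z(i := z i) = z" by simp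
  have verts_s: "verts s = insert v (insert 0 (\<Union>j. fst ` set (?z j)))"
  proof -
    have "verts s = insert 0 (\<Union>j. fst ` set (z j))" by (rule represents_verts[OF rep])
    also have "(\<Union>j. fst ` set (z j)) = insert v (\<Union>j. fst ` set (?z j))"
      using UN_fun_upd_insert[of "\<lambda>_ y. fst ` set y" i "z i" v ?z, unfolded restore] z by simp
    finally show ?thesis by (simp only: insert_commute)
  qed
  have edges_s: "edges s =
    insert (?u, unit_marking (of_bool i), v) (\<Union>j. chain_edges j (?z j))"
  proof -
    have "edges s = (\<Union>j. chain_edges j (z j))" by (rule represents_edges[OF rep])
    also have "\<dots> = insert (?u, unit_marking (of_bool i), v) (\<Union>j. chain_edges j (?z j))"
      using UN_fun_upd_insert[of chain_edges i "z i" "(?u, unit_marking (of_bool i), v)" ?z,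
          unfolded restore] z by simp
    finally show ?thesis .
  qed
  have sub: "set (?z j) \<subseteq> set (z j)" for j using z by auto
  show ?thesis unfolding represents_def
  proof (intro conjI allI ballI)
    fix j
    show "distinct (map fst (?z j))" "0 \<notin> fst ` set (?z j)"
      using represents_distinct[OF rep, of j] z by auto
  next
    show "fst ` set (?z False) \<inter> fst ` set (?z True) = {}"
      using represents_disjoint[OF rep] sub[of False] sub[of True] by blast
  next
    show "verts ?s = insert 0 (\<Union>j. fst ` set (?z j))"
      unfolding verts verts_s using v_z v_fresh(1) by blast
  next
    have "u \<noteq> v \<and> w \<noteq> v" if "(u, m, w) \<in> chain_edges j (?z j)" for u m w j
    proof -
      have "set (tl (?z j)) \<subseteq> set (?z j)" by (cases "?z j") auto
      then show ?thesis
        using chain_edges_source[OF that] chain_edges_target[OF that] v_z[of j] v_fresh(1) by blast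
    qed
    then show "edges ?s = (\<Union>j. chain_edges j (?z j))"
      unfolding edges edges_s by blast
  next
    fix j u d p
    show "(u, d) \<in> set (?z j) \<longrightarrow> mark ?s u (p + 2) = of_bool (p = d)"
    proof
      assume "(u, d) \<in> set (?z j)"
      with sub have "(u, d) \<in> set (z j)" by blast
      then have "mark s u (p + 2) = of_bool (p = d)" by (rule represents_cell[OF rep])
      then show "mark ?s u (p + 2) = of_bool (p = d)" by (auto simp: unit_marking_def)
    qed
  next
    fix p
    show "mark ?s 0 (p + 2) = 0" using represents_root[OF rep, of p] by (simp add: unit_marking_def)
  next
    fix j u assume "u \<in> verts ?s"
    then have u: "u \<in> verts s" "u \<noteq> v" using verts by auto
    then have m: "mark s u (of_bool j) = of_bool (u = top_vertex (z j))"
      by (intro represents_top[OF rep])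
    \<comment> \<open>For \<open>j = i\<close> the only active thread was \<open>v\<close>, which is
      gone; the returned token makes \<open>top_vertex r\<close> the only active one.\<close>
    show "mark ?s u (of_bool j) = of_bool (u = top_vertex (?z j))"
      using m u z by (auto simp: unit_marking_def top_vertex_def)
  qed
qed

section \<open>Firing sequences as executable words\<close>

definition stack_contents :: "(bool \<Rightarrow> (vertex \<times> nat) list) \<Rightarrow> stacks" where
  "stack_contents z = (\<lambda>i. map snd (z i))"

lemma stack_contents_upd: "stack_contents (z(i := y)) = (stack_contents z)(i := map snd y)"
  by (auto simp: stack_contents_def)

lemma stack_net_fire_sound:
  assumes "fire (stack_net K) U s (v, t) s'" and rep: "represents s z" and U: "verts s \<subseteq> U"
  shows "t < 2 * K \<and> (\<exists>z'. represents s' z' \<and>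
    exec_op t (stack_contents z) = Some (stack_contents z'))"
  using assms(1)
proof cases
  case elementary
  then show ?thesis by (simp add: stack_net_def)
next
  case (abstract w)
  then obtain c where t: "t = 2 * c" and lt: "t < 2 * K" by (auto simp: stack_net_def)
  have "unit_marking (of_bool (odd c)) \<le> mark s v"
    using abstract t by (simp add: stack_net_def)
  then have v: "v = top_vertex (z (odd c))" using unit_marking_le_iff[OF rep] abstract by blast
  have w: "w \<notin> verts s" using abstract U by auto
  have "represents s' (z(odd c := (w, c) # z (odd c)))"
    using represents_push[OF rep w v] abstract t by (simp add: stack_net_def)
  then show ?thesis using t lt
    by (auto simp: stack_contents_upd intro!: exI[of _ "z(odd c := (w, c) # z (odd c))"])
      (simp add: stack_contents_def)
next
  \<comment> \<open>Contradictory: a thread that enables a cut stores a symbol and therefore has an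
    incoming edge.\<close>
  case cut_root
  then obtain c where t: "t = Suc (2 * c)" by (auto simp: stack_net_def elim!: oddE)
  have v: "v \<in> verts s" using cut_root by (simp add: is_root_def)
  then obtain r where "z (odd c) = (v, c) # r"
    using cell_marking_le_iff[OF rep v, of c] cut_root t by (auto simp: stack_net_def)
  then have "(top_vertex r, unit_marking (of_bool (odd c)), v) \<in> edges s"
    using edge_into_top[OF rep] by blast
  then show ?thesis using cut_root by (auto simp: is_root_def)
next
  case (cut_child u m)
  then obtain c where t: "t = Suc (2 * c)" and lt: "t < 2 * K"
    by (auto simp: stack_net_def elim!: oddE)
  obtain r where z: "z (odd c) = (v, c) # r"
    using cell_marking_le_iff[OF rep, of v c] cut_child t by (auto simp: stack_net_def)
  have "u = top_vertex r \<and> m = unit_marking (of_bool (odd c))"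
    using edge_into_top[OF rep z] cut_child by blast
  then have "represents s' (z(odd c := r))" using represents_pop[OF rep z] cut_child by simp
  moreover have "exec_op t (stack_contents z) = Some (stack_contents (z(odd c := r)))"
    unfolding t exec_op_pop stack_contents_upd using z by (simp add: stack_contents_def)
  ultimately show ?thesis using lt by blast
qed

lemma stack_net_fire_complete:
  assumes rep: "represents s z" and U: "verts s \<subseteq> U" "finite U" and lt: "t < 2 * K"
    and ex: "exec_op t (stack_contents z) = Some st'"
  shows "\<exists>v s' z'. fire (stack_net K) U s (v, t) s' \<and> represents s' z' \<and> st' = stack_contents z'"
proof (cases "even t")
  case True
  then obtain c where t: "t = 2 * c" by auto
  obtain w where w: "w \<notin> U" using U(2) ex_new_if_finite by blast
  with U(1) have w': "w \<notin> verts s" by blast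
  let ?v = "top_vertex (z (odd c))"
  have v: "?v \<in> verts s" by (rule top_vertex_in_verts[OF rep])
  have "fire (stack_net K) U s (?v, t) \<lparr>verts = insert w (verts s),
      mark = (mark s)(?v := (\<lambda>p. mark s ?v p - W_minus (stack_net K) t p), w := Omega (stack_net K) t),
      edges = insert (?v, W_plus (stack_net K) t, w) (edges s)\<rparr>"
    using v w lt t unit_marking_le_iff[OF rep v] by (intro fire.abstract) (auto simp: stack_net_def)
  moreover have "represents \<lparr>verts = insert w (verts s),
      mark = (mark s)(?v := (\<lambda>p. mark s ?v p - W_minus (stack_net K) t p), w := Omega (stack_net K) t),
      edges = insert (?v, W_plus (stack_net K) t, w) (edges s)\<rparr> (z(odd c := (w, c) # z (odd c)))"
    using represents_push[OF rep w' refl, of c] t by (simp add: stack_net_def)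
  moreover have "st' = stack_contents (z(odd c := (w, c) # z (odd c)))"
    using ex t by (simp add: stack_contents_upd) (simp add: stack_contents_def)
  ultimately show ?thesis by blast
next
  case False
  then obtain c where t: "t = Suc (2 * c)" by (auto elim!: oddE)
  obtain r where r: "stack_contents z (odd c) = c # r" "st' = (stack_contents z)(odd c := r)"
    using ex unfolding t exec_op_pop by blast
  then obtain v y where z: "z (odd c) = (v, c) # y" and y: "map snd y = r"
    by (auto simp: stack_contents_def)
  have v: "v \<in> verts s" using top_vertex_in_verts[OF rep, of "odd c"] z by (simp add: top_vertex_def)
  have "(top_vertex y, unit_marking (of_bool (odd c)), v) \<in> edges s"
    using edge_into_top[OF rep z] by blast
  then have "fire (stack_net K) U s (v, t) ((delete_subtree s v)\<lparr>mark := (mark s)(top_vertex y :=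
      (\<lambda>p. mark s (top_vertex y) p + unit_marking (of_bool (odd c)) p))\<rparr>)"
    using v lt t cell_marking_le_iff[OF rep v] z
    by (intro fire.cut_child) (auto simp: stack_net_def)
  moreover have "st' = stack_contents (z(odd c := y))"
    using r y by (simp add: stack_contents_upd)
  ultimately show ?thesis using represents_pop[OF rep z] by blast
qed

lemma stack_net_run_sound:
  assumes "run (stack_net K) U s \<sigma> s'" and "represents s z" and "verts s \<subseteq> U"
  shows "map snd \<sigma> \<in> lists {..<2 * K} \<and> exec_ops (map snd \<sigma>) (stack_contents z) \<noteq> None"
  using assms
proof (induction arbitrary: z)
  case (run_Cons U s a s' \<sigma> s'')
  obtain v t where a: "a = (v, t)" by fastforce
  from stack_net_fire_sound[OF run_Cons(1)[unfolded a] run_Cons(4,5)] obtain z' where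
    "t < 2 * K" "represents s' z'" "exec_op t (stack_contents z) = Some (stack_contents z')" by blast
  then show ?case using run_Cons.IH[of z'] a by auto
qed auto

lemma stack_net_run_complete:
  assumes "represents s z" and "verts s \<subseteq> U" and "finite U" and "u \<in> lists {..<2 * K}"
    and "exec_ops u (stack_contents z) \<noteq> None"
  shows "\<exists>\<sigma> s'. run (stack_net K) U s \<sigma> s' \<and> map snd \<sigma> = u"
  using assms
proof (induction u arbitrary: s z U)
  case Nil
  show ?case using run_Nil by fastforce
next
  case (Cons t u)
  from Cons.prems obtain st' where st': "exec_op t (stack_contents z) = Some st'"
    "exec_ops u st' \<noteq> None" by (cases "exec_op t (stack_contents z)") auto
  have "t < 2 * K" using Cons.prems by auto
  from stack_net_fire_complete[OF Cons.prems(1,2,3) this st'(1)] obtain v s' z' where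
    s': "fire (stack_net K) U s (v, t) s'" "represents s' z'" "st' = stack_contents z'" by blast
  have "finite (verts s')" using represents_verts[OF s'(2)] by auto
  then obtain \<sigma> s'' where "run (stack_net K) (U \<union> verts s') s' \<sigma> s''" "map snd \<sigma> = u"
    using Cons.IH[OF s'(2), of "U \<union> verts s'"] Cons.prems s' st' by auto
  then show ?case using run_Cons[OF s'(1)] by (metis list.map(2) snd_conv)
qed

text \<open>The only final state is \<open>empty_state\<close>, which lies below every state, so
  covering imposes no condition. Transitions are the operation numbers themselves and are labelled
  by \<open>Some\<close>, so a label word is just the sequence of operations.\<close>

lemma stack_language:
  "rpn_coverability_language {..<2 * K} {u \<in> lists {..<2 * K}. exec_ops u (\<lambda>_. []) \<noteq> None}"
proof -
  have "is_rpn (stack_net K)"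
    by (auto simp: is_rpn_def stack_net_def transitions_def markings_def unit_marking_def
        cell_marking_def of_bool_def)
  moreover have "is_labelling (stack_net K) {..<2 * K} Some"
    by (auto simp: is_labelling_def transitions_def stack_net_def)
  moreover have "is_state (stack_net K) stack_init"
    by (auto simp: is_state_def stack_init_def finite_rooted_tree_def is_root_def child_rel_def
        subtree_verts_def markings_def stack_net_def)
  moreover have "is_state (stack_net K) empty_state"
    by (simp add: is_state_def empty_state_def)
  moreover have "{u \<in> lists {..<2 * K}. exec_ops u (\<lambda>_. []) \<noteq> None} =
    cov_lang (stack_net K) Some stack_init {empty_state}"
  proof -
    have lab: "label_word Some \<sigma> = map snd \<sigma>" for \<sigma> :: "(vertex \<times> nat) list"
      by (induction \<sigma>) (auto simp: label_word_def)
    have le: "empty_state \<preceq> s" for s :: "nat state" by (simp add: state_le_def empty_state_def)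
    have cont: "stack_contents (\<lambda>_. []) = (\<lambda>_. [])" by (simp add: stack_contents_def)
    have fin: "finite (verts stack_init)" by (simp add: stack_init_def)
    show ?thesis
    proof (intro equalityI subsetI)
      fix u assume "u \<in> {u \<in> lists {..<2 * K}. exec_ops u (\<lambda>_. []) \<noteq> None}"
      then obtain \<sigma> s where "run (stack_net K) (verts stack_init) stack_init \<sigma> s" "map snd \<sigma> = u"
        using stack_net_run_complete[OF represents_init order_refl fin, unfolded cont] by blast
      then show "u \<in> cov_lang (stack_net K) Some stack_init {empty_state}"
        using le unfolding cov_lang_def firing_sequence_def lab by blast
    next
      fix u assume "u \<in> cov_lang (stack_net K) Some stack_init {empty_state}"
      then obtain \<sigma> s where "run (stack_net K) (verts stack_init) stack_init \<sigma> s" "map snd \<sigma> = u"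
        unfolding cov_lang_def firing_sequence_def lab by blast
      then show "u \<in> {u \<in> lists {..<2 * K}. exec_ops u (\<lambda>_. []) \<noteq> None}"
        using stack_net_run_sound[OF _ represents_init order_refl, unfolded cont] by blast
    qed
  qed
  ultimately show ?thesis unfolding rpn_coverability_language_def by blast
qed

section \<open>Simulation of Turing machines\<close>

text \<open>Both lists run outwards from the head, so that list heads are stack tops. The scanned
  cell belongs to the right list; hence the \<open>- 1\<close> here.\<close>

definition left_cells :: "(int \<Rightarrow> 'g) \<Rightarrow> int \<Rightarrow> nat \<Rightarrow> 'g list" where
  "left_cells tape i m = map (\<lambda>j. tape (i - 1 - int j)) [0..<m]"

definition right_cells :: "(int \<Rightarrow> 'g) \<Rightarrow> int \<Rightarrow> nat \<Rightarrow> 'g list" where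
  "right_cells tape i n = map (\<lambda>j. tape (i + int j)) [0..<n]"

lemma cells_0 [simp]: "left_cells tape i 0 = []" "right_cells tape i 0 = []"
  by (simp_all add: left_cells_def right_cells_def)

lemma left_cells_Suc: "left_cells tape i (Suc m) = tape (i - 1) # left_cells tape (i - 1) m"
  unfolding left_cells_def map_upt_Suc by (simp add: algebra_simps)

lemma right_cells_Suc: "right_cells tape i (Suc n) = tape i # right_cells tape (i + 1) n"
  unfolding right_cells_def map_upt_Suc by (simp add: algebra_simps)

lemma left_cells_upd: "i \<le> k \<Longrightarrow> left_cells (tape(k := y)) i m = left_cells tape i m"
  by (auto simp: left_cells_def)

lemma right_cells_upd: "k < i \<Longrightarrow> right_cells (tape(k := y)) i n = right_cells tape i n"
  by (auto simp: right_cells_def)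

datatype control = Load | Reading | Rewind | Sim nat

locale tm_simulation =
  fixes M :: "(nat, 'a + nat) tm" and \<Sigma> :: "'a set" and code :: "'a + nat \<Rightarrow> nat" and n :: nat
  assumes tm: "is_tm M" and input: "tm_input M = Inl ` \<Sigma>"
    and code_inj: "inj_on code (tm_tape M)" and code_less: "x \<in> tm_tape M \<Longrightarrow> code x < n"
begin

abbreviation "\<Gamma> \<equiv> tm_tape M"
abbreviation "B \<equiv> tm_blank M"

text \<open>Input letters are pushed as separate symbols \<open>input_sym a\<close>: these pushes are what the
  homomorphism keeps, and while rewinding they tell the input from the blanks to its left.\<close>

definition left_sym :: "'a + nat \<Rightarrow> nat" where "left_sym x = 4 * code x"
definition input_sym :: "'a \<Rightarrow> nat" where "input_sym a = 4 * code (Inl a) + 2"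
definition right_sym :: "'a + nat \<Rightarrow> nat" where "right_sym x = 2 * code x + 1"

text \<open>Parity selects the stack in \<open>exec_op\<close>: index \<open>False\<close> gets the
  tape left of the head, \<open>True\<close> the rest. Residues 0 and 2 modulo 4 separate tape
  symbols from input symbols on the left stack.\<close>

lemma sym_parity [simp]: "even (left_sym x)" "even (input_sym a)" "odd (right_sym x)"
  by (simp_all add: left_sym_def input_sym_def right_sym_def)

lemma sym_neq [simp]: "left_sym x \<noteq> input_sym a" "input_sym a \<noteq> left_sym x"
  "right_sym x \<noteq> input_sym a"
  unfolding left_sym_def input_sym_def right_sym_def by presburger+

lemma sym_inj:
  "\<lbrakk>x \<in> \<Gamma>; y \<in> \<Gamma>\<rbrakk> \<Longrightarrow> left_sym x = left_sym y \<longleftrightarrow> x = y"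
  "\<lbrakk>x \<in> \<Gamma>; y \<in> \<Gamma>\<rbrakk> \<Longrightarrow> right_sym x = right_sym y \<longleftrightarrow> x = y"
  using code_inj by (auto simp: left_sym_def right_sym_def inj_on_def)

lemma Inl_tape: "a \<in> \<Sigma> \<Longrightarrow> Inl a \<in> \<Gamma>" and blank_tape: "B \<in> \<Gamma>"
  and start_state: "tm_start M \<in> tm_states M"
  using tm input by (auto simp: is_tm_def)

lemma input_sym_inj: "\<lbrakk>a \<in> \<Sigma>; b \<in> \<Sigma>\<rbrakk> \<Longrightarrow> input_sym a = input_sym b \<longleftrightarrow> a = b"
  using code_inj Inl_tape by (auto simp: input_sym_def inj_on_def)

text \<open>With codes at most \<open>n - 1\<close>, the largest possible value is
  \<open>4 * (n - 1) + 2\<close>. So \<open>4 * n\<close> stack symbols suffice, with two operations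
  each.\<close>

lemma sym_less:
  "x \<in> \<Gamma> \<Longrightarrow> left_sym x < 4 * n" "x \<in> \<Gamma> \<Longrightarrow> right_sym x < 4 * n" "a \<in> \<Sigma> \<Longrightarrow> input_sym a < 4 * n"
  using code_less[of x] code_less[OF Inl_tape, of a]
  by (simp_all add: left_sym_def right_sym_def input_sym_def)

abbreviation push :: "nat \<Rightarrow> nat" where "push c \<equiv> 2 * c"
abbreviation pop :: "nat \<Rightarrow> nat" where "pop c \<equiv> Suc (2 * c)"

text \<open>After a left move the new scanned symbol is known only to the left stack, so there is
  one edge for each candidate \<open>z\<close>; only the one naming the actual top can be
  executed.\<close>

definition step_edges :: "nat \<Rightarrow> 'a + nat \<Rightarrow> (control \<times> nat list \<times> control) set" where
  "step_edges q x = (case tm_delta M q x of None \<Rightarrow> {} | Some (q', y, d) \<Rightarrow>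
     (case d of
        Right \<Rightarrow> {(Sim q, [pop (right_sym x), push (left_sym y)], Sim q')}
      | Left \<Rightarrow> (\<lambda>z. (Sim q, [pop (right_sym x), push (right_sym y), pop (left_sym z),
                 push (right_sym z)], Sim q')) ` \<Gamma>))"

text \<open>The number of blanks on both sides is guessed in \<open>Load\<close>. At least one blank is on the left,
  so that the end of the rewinding phase can be detected; the blank pushed on the way to
  \<open>Rewind\<close> only serves to keep the edge label non-empty. In \<open>Sim q\<close>, the scanned cell is the top
  of the right stack.\<close>

definition control_edges :: "(control \<times> nat list \<times> control) set" where
  "control_edges =
     {(Load, [push (left_sym B)], Load), (Load, [push (right_sym B)], Load),
      (Load, [push (left_sym B)], Reading), (Reading, [push (right_sym B)], Rewind),
      (Rewind, [pop (left_sym B), push (left_sym B)], Sim (tm_start M))} \<union>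
     (\<lambda>a. (Reading, [push (input_sym a)], Reading)) ` \<Sigma> \<union>
     (\<lambda>a. (Rewind, [pop (input_sym a), push (right_sym (Inl a))], Rewind)) ` \<Sigma> \<union>
     (\<Union>q \<in> tm_states M. \<Union>x \<in> \<Gamma>. step_edges q x)"

lemma control_edges_cases [consumes 1]:
  assumes "(p, u, q) \<in> control_edges"
  obtains (blank_left) "p = Load" "u = [push (left_sym B)]" "q = Load"
  | (blank_right) "p = Load" "u = [push (right_sym B)]" "q = Load"
  | (start_reading) "p = Load" "u = [push (left_sym B)]" "q = Reading"
  | (start_rewind) "p = Reading" "u = [push (right_sym B)]" "q = Rewind"
  | (start_sim) "p = Rewind" "u = [pop (left_sym B), push (left_sym B)]" "q = Sim (tm_start M)"
  | (read) a where "a \<in> \<Sigma>" "p = Reading" "u = [push (input_sym a)]" "q = Reading"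
  | (rewind) a where "a \<in> \<Sigma>" "p = Rewind"
      "u = [pop (input_sym a), push (right_sym (Inl a))]" "q = Rewind"
  | (step_right) q1 x q2 y where "q1 \<in> tm_states M" "x \<in> \<Gamma>"
      "tm_delta M q1 x = Some (q2, y, Right)"
      "p = Sim q1" "u = [pop (right_sym x), push (left_sym y)]" "q = Sim q2"
  | (step_left) q1 x q2 y z where "q1 \<in> tm_states M" "x \<in> \<Gamma>" "z \<in> \<Gamma>"
      "tm_delta M q1 x = Some (q2, y, Left)"
      "p = Sim q1" "q = Sim q2"
      "u = [pop (right_sym x), push (right_sym y), pop (left_sym z), push (right_sym z)]"
proof -
  have thesis if q1: "q1 \<in> tm_states M" and x: "x \<in> \<Gamma>" and e: "(p, u, q) \<in> step_edges q1 x" for q1 x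
  proof -
    obtain q2 y d where d: "tm_delta M q1 x = Some (q2, y, d)"
      using e by (auto simp: step_edges_def split: option.splits)
    show thesis
    proof (cases d)
      case Left
      with d e obtain z where "z \<in> \<Gamma>" "p = Sim q1" "q = Sim q2"
        "u = [pop (right_sym x), push (right_sym y), pop (left_sym z), push (right_sym z)]"
        by (auto simp: step_edges_def)
      then show thesis using step_left[OF q1 x] d Left by blast
    next
      case Right
      with d e have "p = Sim q1" "u = [pop (right_sym x), push (left_sym y)]" "q = Sim q2"
        by (auto simp: step_edges_def)
      then show thesis using step_right[OF q1 x] d Right by blast
    qed
  qed
  then show thesis
    using assms that(1-7) unfolding control_edges_def by blast
qed

lemma delta_closed:
  assumes "q \<in> tm_states M" "x \<in> \<Gamma>" "tm_delta M q x = Some (q', y, d)"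
  shows "q' \<in> tm_states M" "y \<in> \<Gamma>"
  using tm assms unfolding is_tm_def by blast+

lemma finite_control_edges: "finite control_edges"
proof -
  have fin: "finite (tm_states M)" "finite \<Gamma>" "finite (tm_input M)"
    using tm by (auto simp: is_tm_def intro: finite_subset)
  then have "finite \<Sigma>" unfolding input by (simp add: finite_image_iff)
  moreover have "finite (step_edges q x)" for q x
    using fin by (auto simp: step_edges_def split: option.splits direction.splits)
  ultimately show ?thesis using fin by (simp add: control_edges_def)
qed

lemma control_edges_alphabet:
  assumes "(p, u, q) \<in> control_edges"
  shows "u \<in> lists {..<2 * (4 * n)} \<and> u \<noteq> []"
proof -
  have "push c < 2 * (4 * n)" "pop c < 2 * (4 * n)" if "c < 4 * n" for c using that by auto
  then have less: "push (left_sym x) < 2 * (4 * n)" "pop (left_sym x) < 2 * (4 * n)"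
    "push (right_sym x) < 2 * (4 * n)" "pop (right_sym x) < 2 * (4 * n)" if "x \<in> \<Gamma>" for x
    using sym_less that by blast+
  have less': "push (input_sym a) < 2 * (4 * n)" "pop (input_sym a) < 2 * (4 * n)" if "a \<in> \<Sigma>" for a
    using sym_less(3)[OF that] by auto
  show ?thesis using assms
  proof (cases rule: control_edges_cases)
    case step_right
    then show ?thesis using less delta_closed(2)[OF step_right(1-3)] by simp
  next
    case step_left
    then show ?thesis using less delta_closed(2)[OF step_left(1,2,4)] by simp
  qed (use less[OF blank_tape] less' less[OF Inl_tape] in simp_all)
qed

section \<open>The homomorphism\<close>

text \<open>Inverts \<open>input_sym\<close> on pushes only. Pops of input symbols and the pushes
  that copy them to the right stack are erased, so rewinding does not output the input
  again.\<close>

definition letter :: "nat \<Rightarrow> 'a list" where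
  "letter t = (if \<exists>a \<in> \<Sigma>. t = push (input_sym a)
     then [THE a. a \<in> \<Sigma> \<and> t = push (input_sym a)] else [])"

definition output_word :: "nat list \<Rightarrow> 'a list" where
  "output_word u = concat (map letter u)"

lemma letter_input [simp]: "a \<in> \<Sigma> \<Longrightarrow> letter (push (input_sym a)) = [a]"
  unfolding letter_def by (auto simp: input_sym_inj)

lemma letter_other [simp]: "letter (push (left_sym x)) = []" "letter (push (right_sym x)) = []"
  "letter (pop c) = []"
  unfolding letter_def by (auto simp: eq_commute[of "Suc _"]) presburger+

lemma letter_in: "letter t \<in> lists \<Sigma>"
proof (cases "\<exists>a \<in> \<Sigma>. t = push (input_sym a)")
  case True
  then show ?thesis by (auto simp del: mult_cancel1)
qed (simp add: letter_def)

lemma output_word_simps [simp]: "output_word [] = []" "output_word (t # u) = letter t @ output_word u"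
  by (simp_all add: output_word_def)

lemma output_word_append [simp]: "output_word (u @ v) = output_word u @ output_word v"
  by (simp add: output_word_def)

section \<open>Tape windows and soundness of the simulation\<close>

fun wf_config :: "(nat, 'a + nat) config \<Rightarrow> bool" where
  "wf_config (q, tape, i) \<longleftrightarrow> q \<in> tm_states M \<and> range tape \<subseteq> \<Gamma>"

text \<open>The stacks hold a finite window of the infinite tape. Its extents \<open>l\<close> and
  \<open>r\<close> are parameters because every move shifts a cell from one side to the
  other.\<close>

fun encodes :: "stacks \<Rightarrow> (nat, 'a + nat) config \<Rightarrow> nat \<Rightarrow> nat \<Rightarrow> bool" where
  "encodes st (q, tape, i) l r \<longleftrightarrow>
     st False = map left_sym (left_cells tape i l) \<and> st True = map right_sym (right_cells tape i r)"

lemma wf_config_step: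
  assumes "tm_step M c c'" and "wf_config c"
  shows "wf_config c'"
  using assms(1)
proof cases
  case (1 q tape i q' y d)
  have q: "q \<in> tm_states M" and tape: "range tape \<subseteq> \<Gamma>" using assms(2) 1(1) by auto
  have "tape i \<in> \<Gamma>" using tape by blast
  note closed = delta_closed[OF q this 1(3)]
  have "range (tape(i := y)) \<subseteq> \<Gamma>" using tape closed(2) by (auto simp: image_subset_iff)
  then show ?thesis unfolding 1(2) using closed(1) by simp
qed

lemma wf_config_initial: "v \<in> lists \<Sigma> \<Longrightarrow> wf_config (tm_initial M (map Inl v))"
  using start_state blank_tape Inl_tape by (auto simp: tm_initial_def)

lemma encodes_initial:
  assumes "st False = replicate l (left_sym B)"
    and "st True = map (\<lambda>a. right_sym (Inl a)) v @ replicate r (right_sym B)"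
  shows "encodes st (tm_initial M (map Inl v)) l (length v + r)"
proof -
  have "map left_sym (left_cells (\<lambda>i. if 0 \<le> i \<and> i < int (length v) then map Inl v ! nat i else B) 0 l)
    = replicate l (left_sym B)"
    by (rule nth_equalityI) (auto simp: left_cells_def)
  moreover have "map right_sym
      (right_cells (\<lambda>i. if 0 \<le> i \<and> i < int (length v) then map Inl v ! nat i else B) 0 (length v + r))
    = map (\<lambda>a. right_sym (Inl a)) v @ replicate r (right_sym B)"
    by (rule nth_equalityI) (auto simp: right_cells_def nth_append)
  ultimately show ?thesis using assms by (simp add: tm_initial_def)
qed

text \<open>The soundness invariant: \<open>v\<close> is the output so far. \<open>Suc l\<close>
  records the blank beneath the input by which the end of rewinding is recognised; \<open>v1\<close>
  is the part of the input not yet moved to the right stack.\<close>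

fun reached :: "control \<Rightarrow> 'a list \<Rightarrow> stacks \<Rightarrow> bool" where
  "reached Load v st \<longleftrightarrow> v = [] \<and>
     (\<exists>l r. st False = replicate l (left_sym B) \<and> st True = replicate r (right_sym B))"
| "reached Reading v st \<longleftrightarrow> v \<in> lists \<Sigma> \<and>
     (\<exists>l r. st False = rev (map input_sym v) @ replicate (Suc l) (left_sym B) \<and>
        st True = replicate r (right_sym B))"
| "reached Rewind v st \<longleftrightarrow> v \<in> lists \<Sigma> \<and>
     (\<exists>l r v1 v2. v = v1 @ v2 \<and>
        st False = rev (map input_sym v1) @ replicate (Suc l) (left_sym B) \<and>
        st True = map (\<lambda>a. right_sym (Inl a)) v2 @ replicate r (right_sym B))"
| "reached (Sim q) v st \<longleftrightarrow> v \<in> lists \<Sigma> \<and>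
     (\<exists>tape i l r. (tm_step M)\<^sup>*\<^sup>* (tm_initial M (map Inl v)) (q, tape, i) \<and>
        wf_config (q, tape, i) \<and> encodes st (q, tape, i) l r)"

lemma reached_edge:
  assumes "(p, u, q) \<in> control_edges" and p: "reached p v st" and ex: "exec_ops u st = Some st'"
  shows "reached q (v @ output_word u) st'"
  using assms(1)
proof (cases rule: control_edges_cases)
  case blank_left
  with p ex show ?thesis by (auto simp flip: replicate_Suc)
next
  case blank_right
  with p ex show ?thesis by (auto simp flip: replicate_Suc)
next
  case start_reading
  with p ex show ?thesis by auto
next
  case start_rewind
  from p[unfolded start_rewind, simplified] obtain l r where v: "v \<in> lists \<Sigma>"
    and st: "st False = rev (map input_sym v) @ replicate (Suc l) (left_sym B)"
      "st True = replicate r (right_sym B)" by auto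
  \<comment> \<open>Nothing has been moved yet, so the split is \<open>v @ []\<close>; the blank
    pushed by this edge joins the padding on the right.\<close>
  have "st' False = rev (map input_sym v) @ replicate (Suc l) (left_sym B) \<and>
    st' True = map (\<lambda>a. right_sym (Inl a)) [] @ replicate (Suc r) (right_sym B)"
    using ex st start_rewind by auto
  then have "reached Rewind v st'" unfolding reached.simps using v by (metis append_Nil2)
  then show ?thesis using start_rewind by simp
next
  case start_sim
  from p[unfolded start_sim reached.simps] obtain l r v1 v2 where v: "v \<in> lists \<Sigma>" "v = v1 @ v2"
    and st: "st False = rev (map input_sym v1) @ replicate (Suc l) (left_sym B)"
      "st True = map (\<lambda>a. right_sym (Inl a)) v2 @ replicate r (right_sym B)" by blast
  have "hd (st False) = left_sym B" and st': "st' = st"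
    using ex start_sim by (auto simp: bind_eq_Some_conv exec_op_pop)
  \<comment> \<open>If some input were left, an input symbol would be on top and popping a blank
    would block.\<close>
  then have "v1 = []" using st by (cases v1 rule: rev_cases) auto
  then have "encodes st' (tm_initial M (map Inl v)) (Suc l) (length v + r)"
    using st v st' by (intro encodes_initial) auto
  moreover obtain tape where "tm_initial M (map Inl v) = (tm_start M, tape, 0)"
    by (simp add: tm_initial_def)
  ultimately have "reached (Sim (tm_start M)) v st'" unfolding reached.simps
    using v(1) wf_config_initial[OF v(1)] by (metis rtranclp.rtrancl_refl)
  then show ?thesis using start_sim by simp
next
  case (read a)
  with p ex show ?thesis by auto
next
  case (rewind a)
  from p[unfolded rewind reached.simps] obtain l r v1 v2 where v: "v \<in> lists \<Sigma>" "v = v1 @ v2"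
    and st: "st False = rev (map input_sym v1) @ replicate (Suc l) (left_sym B)"
      "st True = map (\<lambda>a. right_sym (Inl a)) v2 @ replicate r (right_sym B)" by blast
  obtain rest where rest: "st False = input_sym a # rest"
      "st' = st(False := rest, True := right_sym (Inl a) # st True)"
    using ex rewind by (auto simp: bind_eq_Some_conv exec_op_pop)
  \<comment> \<open>An input symbol was popped, so \<open>v1\<close> is not exhausted; by the
    reversal its last letter is on top.\<close>
  then obtain v1' b where v1: "v1 = v1' @ [b]" using st by (cases v1 rule: rev_cases) auto
  with v rest st have "input_sym b = input_sym a" "b \<in> \<Sigma>" by auto
  then have "b = a" using input_sym_inj rewind(1) by blast
  then have "v = v1' @ (a # v2) \<and>
    st' False = rev (map input_sym v1') @ replicate (Suc l) (left_sym B) \<and>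
    st' True = map (\<lambda>a. right_sym (Inl a)) (a # v2) @ replicate r (right_sym B)"
    using v v1 rest st by auto
  then have "reached Rewind v st'" unfolding reached.simps using v by blast
  then show ?thesis using rewind by simp
next
  case (step_right q1 x q2 y)
  from p[unfolded step_right reached.simps] obtain tape i l r where v: "v \<in> lists \<Sigma>"
    and steps: "(tm_step M)\<^sup>*\<^sup>* (tm_initial M (map Inl v)) (q1, tape, i)"
    and wf: "wf_config (q1, tape, i)" and st: "encodes st (q1, tape, i) l r" by blast
  obtain rest where rest: "st True = right_sym x # rest"
      "st' = st(True := rest, False := left_sym y # st False)"
    using ex step_right by (auto simp: bind_eq_Some_conv exec_op_pop)
  \<comment> \<open>The pop has succeeded, so the window is non-empty: too few guessed blanks can
    never cause a false step.\<close>
  with st obtain r' where r': "r = Suc r'" by (cases r) auto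
  have "right_sym x = right_sym (tape i)" using rest st r' by (simp add: right_cells_Suc)
  then have x: "x = tape i" using sym_inj(2) step_right(2) wf by (metis range_subsetD wf_config.simps)
  have "tm_step M (q1, tape, i) (q2, tape(i := y), move_head Right i)"
    by (rule tm_step.intros) (use step_right x in simp)
  then have step: "tm_step M (q1, tape, i) (q2, tape(i := y), i + 1)" by simp
  have "encodes st' (q2, tape(i := y), i + 1) (Suc l) r'"
    using st rest r' by (simp add: left_cells_Suc right_cells_Suc left_cells_upd right_cells_upd)
  then have "reached (Sim q2) v st'" unfolding reached.simps
    using v rtranclp.rtrancl_into_rtrancl[OF steps step] wf_config_step[OF step wf] by blast
  then show ?thesis using step_right by simp
next
  case (step_left q1 x q2 y z)
  from p[unfolded step_left reached.simps] obtain tape i l r where v: "v \<in> lists \<Sigma>"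
    and steps: "(tm_step M)\<^sup>*\<^sup>* (tm_initial M (map Inl v)) (q1, tape, i)"
    and wf: "wf_config (q1, tape, i)" and st: "encodes st (q1, tape, i) l r" by blast
  obtain rest restl where rest: "st True = right_sym x # rest" "st False = left_sym z # restl"
      "st' = st(True := right_sym z # right_sym y # rest, False := restl)"
    using ex step_left by (auto simp: bind_eq_Some_conv exec_op_pop fun_upd_twist)
  with st obtain r' where r': "r = Suc r'" by (cases r) auto
  from rest st obtain l' where l': "l = Suc l'" by (cases l) auto
  have "right_sym x = right_sym (tape i)" "left_sym z = left_sym (tape (i - 1))"
    using rest st r' l' by (simp_all add: right_cells_Suc left_cells_Suc)
  then have x: "x = tape i" and z: "z = tape (i - 1)"
    using sym_inj step_left(2,3) wf by (metis range_subsetD wf_config.simps)+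
  have "tm_step M (q1, tape, i) (q2, tape(i := y), move_head Left i)"
    by (rule tm_step.intros) (use step_left x in simp)
  then have step: "tm_step M (q1, tape, i) (q2, tape(i := y), i - 1)" by simp
  have "encodes st' (q2, tape(i := y), i - 1) l' (Suc (Suc r'))"
    using st rest r' l' z by (simp add: left_cells_Suc right_cells_Suc left_cells_upd right_cells_upd)
  then have "reached (Sim q2) v st'" unfolding reached.simps
    using v rtranclp.rtrancl_into_rtrancl[OF steps step] wf_config_step[OF step wf] by blast
  then show ?thesis using step_left by simp
qed

lemma reached_path:
  "\<lbrakk>word_path control_edges p u q; reached p v st; exec_ops u st = Some st'\<rbrakk>
    \<Longrightarrow> reached q (v @ output_word u) st'"
proof (induction arbitrary: v st rule: word_path.induct)
  case (word_path_step p u q w r)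
  then obtain st1 where st1: "exec_ops u st = Some st1" "exec_ops w st1 = Some st'"
    by (auto simp: exec_ops_append bind_eq_Some_conv)
  show ?case
    using word_path_step.IH[OF reached_edge[OF word_path_step.hyps(1) word_path_step.prems(1) st1(1)] st1(2)]
    by simp
qed auto

lemma simulation_sound:
  assumes "word_path control_edges Load u (Sim q)" and "q \<in> tm_accept M"
    and "exec_ops u (\<lambda>_. []) \<noteq> None"
  shows "map Inl (output_word u) \<in> tm_lang M"
proof -
  obtain st where "exec_ops u (\<lambda>_. []) = Some st" using assms by auto
  then have "reached (Sim q) ([] @ output_word u) st" using assms by (intro reached_path) auto
  then show ?thesis using assms by (auto simp: tm_lang_def tm_accepts_def input)
qed

section \<open>Completeness: building accepted words\<close>

text \<open>Hides the operation word, so that the accepting run is composed by transitivity while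
  only its stacks and its output are tracked.\<close>

definition leads_to :: "control \<Rightarrow> stacks \<Rightarrow> 'a list \<Rightarrow> control \<Rightarrow> stacks \<Rightarrow> bool" where
  "leads_to p st v q st' \<longleftrightarrow>
     (\<exists>u. word_path control_edges p u q \<and> exec_ops u st = Some st' \<and> output_word u = v)"

lemma leads_to_refl: "leads_to p st [] p st"
  unfolding leads_to_def by (intro exI[of _ "[]"]) (auto intro: word_path_Nil)

lemma leads_to_trans:
  assumes "leads_to p st v q st'" "leads_to q st' v' r st''"
  shows "leads_to p st (v @ v') r st''"
proof -
  obtain u u' where "word_path control_edges p u q" "exec_ops u st = Some st'" "output_word u = v"
    "word_path control_edges q u' r" "exec_ops u' st' = Some st''" "output_word u' = v'"
    using assms unfolding leads_to_def by blast
  then show ?thesis unfolding leads_to_def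
    by (intro exI[of _ "u @ u'"]) (auto simp: exec_ops_append intro: word_path_append)
qed

lemma leads_to_edge:
  "\<lbrakk>(p, u, q) \<in> control_edges; exec_ops u st = Some st'; output_word u = v\<rbrakk> \<Longrightarrow> leads_to p st v q st'"
  unfolding leads_to_def by (intro exI[of _ u]) (simp add: word_path_single)

lemma load_left: "leads_to Load st [] Load (st(False := replicate l (left_sym B) @ st False))"
proof (induction l)
  case 0
  show ?case using leads_to_refl by simp
next
  case (Suc l)
  have "leads_to Load (st(False := replicate l (left_sym B) @ st False)) [] Load
    (st(False := replicate (Suc l) (left_sym B) @ st False))"
    by (rule leads_to_edge[of _ "[push (left_sym B)]"]) (simp_all add: control_edges_def)
  from leads_to_trans[OF Suc this] show ?case by (simp only: append.simps)
qed

lemma load_right: "leads_to Load st [] Load (st(True := replicate r (right_sym B) @ st True))"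
proof (induction r)
  case 0
  show ?case using leads_to_refl by simp
next
  case (Suc r)
  have "leads_to Load (st(True := replicate r (right_sym B) @ st True)) [] Load
    (st(True := replicate (Suc r) (right_sym B) @ st True))"
    by (rule leads_to_edge[of _ "[push (right_sym B)]"]) (simp_all add: control_edges_def)
  from leads_to_trans[OF Suc this] show ?case by (simp only: append.simps)
qed

lemma read_word:
  "v \<in> lists \<Sigma> \<Longrightarrow> leads_to Reading st v Reading (st(False := rev (map input_sym v) @ st False))"
proof (induction v arbitrary: st)
  case Nil
  show ?case using leads_to_refl by simp
next
  case (Cons a v)
  let ?st = "st(False := input_sym a # st False)"
  have "leads_to Reading st [a] Reading ?st"
    by (rule leads_to_edge[of _ "[push (input_sym a)]"]) (use Cons in \<open>auto simp: control_edges_def\<close>)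
  moreover have "leads_to Reading ?st v Reading (?st(False := rev (map input_sym v) @ ?st False))"
    using Cons.prems by (intro Cons.IH) simp
  moreover have "?st(False := rev (map input_sym v) @ ?st False) =
    st(False := rev (map input_sym (a # v)) @ st False)" by simp
  ultimately show ?case using leads_to_trans[of Reading st "[a]" Reading ?st v]
    by (simp only: append.simps)
qed

text \<open>The last letter of \<open>v\<close> is on top, hence induction from the right end;
  pushing the letters in that order puts the first one on top of the right stack.\<close>

lemma rewind_word:
  "\<lbrakk>v \<in> lists \<Sigma>; st False = rev (map input_sym v) @ xs\<rbrakk> \<Longrightarrow>
   leads_to Rewind st [] Rewind (st(False := xs, True := map (\<lambda>a. right_sym (Inl a)) v @ st True))"
proof (induction v arbitrary: st rule: rev_induct)
  case Nil
  then have "st(False := xs, True := map (\<lambda>a. right_sym (Inl a)) [] @ st True) = st" by auto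
  then show ?case using leads_to_refl by (simp only:)
next
  case (snoc a v)
  let ?st = "st(False := rev (map input_sym v) @ xs, True := right_sym (Inl a) # st True)"
  have "leads_to Rewind st [] Rewind ?st"
  proof (rule leads_to_edge[of _ "[pop (input_sym a), push (right_sym (Inl a))]"])
    have "exec_op (pop (input_sym a)) st = Some (st(False := rev (map input_sym v) @ xs))"
      unfolding exec_op_pop using snoc.prems by simp
    then show "exec_ops [pop (input_sym a), push (right_sym (Inl a))] st = Some ?st" by simp
  qed (use snoc in \<open>auto simp: control_edges_def\<close>)
  moreover have "leads_to Rewind ?st [] Rewind
    (?st(False := xs, True := map (\<lambda>a. right_sym (Inl a)) v @ ?st True))"
    using snoc by (intro snoc.IH) auto
  moreover have "?st(False := xs, True := map (\<lambda>a. right_sym (Inl a)) v @ ?st True) =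
    st(False := xs, True := map (\<lambda>a. right_sym (Inl a)) (v @ [a]) @ st True)" by auto
  ultimately show ?case using leads_to_trans[of Rewind st "[]" Rewind ?st "[]"]
    by (simp only: append.simps)
qed

text \<open>\<open>l\<close> and \<open>r\<close> blanks come from the loops at \<open>Load\<close>;
  the two successors are the blanks pushed on the edges to \<open>Reading\<close> and to
  \<open>Rewind\<close>.\<close>

lemma leads_to_initial:
  assumes v: "v \<in> lists \<Sigma>"
  shows "\<exists>st. leads_to Load (\<lambda>_. []) v (Sim (tm_start M)) st \<and>
    encodes st (tm_initial M (map Inl v)) (Suc l) (length v + Suc r)"
proof -
  let ?l = "replicate l (left_sym B)" and ?r = "replicate r (right_sym B)"
  let ?w = "map (\<lambda>a. right_sym (Inl a)) v"
  define st :: stacks where "st = (\<lambda>i. if i then ?r else ?l)"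
  define st1 where "st1 = st(False := left_sym B # ?l)"
  define st2 where "st2 = st1(False := rev (map input_sym v) @ left_sym B # ?l)"
  define st3 where "st3 = st2(True := right_sym B # ?r)"
  define st4 where "st4 = st3(False := left_sym B # ?l, True := ?w @ right_sym B # ?r)"
  have 0: "leads_to Load (\<lambda>_. []) ([] @ []) Load st"
  proof (rule leads_to_trans)
    show "leads_to Load (\<lambda>_. []) [] Load ((\<lambda>_. [])(False := ?l))"
      using load_left[of "\<lambda>_. []" l] by simp
    have "((\<lambda>_. [])(False := ?l))(True := ?r @ ((\<lambda>_. [])(False := ?l)) True) = st"
      by (auto simp: st_def)
    then show "leads_to Load ((\<lambda>_. [])(False := ?l)) [] Load st"
      using load_right[of "(\<lambda>_. [])(False := ?l)" r] by simp
  qed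
  have 1: "leads_to Load st [] Reading st1"
    by (rule leads_to_edge[of _ "[push (left_sym B)]"])
      (simp_all add: control_edges_def st1_def st_def)
  have 2: "leads_to Reading st1 v Reading st2"
    using read_word[OF v, of st1] by (simp add: st2_def st1_def)
  have 3: "leads_to Reading st2 [] Rewind st3"
    by (rule leads_to_edge[of _ "[push (right_sym B)]"])
      (simp_all add: control_edges_def st3_def st2_def st1_def st_def)
  have 4: "leads_to Rewind st3 [] Rewind st4"
    using rewind_word[OF v, of st3 "left_sym B # ?l"] by (simp add: st4_def st3_def st2_def)
  have 5: "leads_to Rewind st4 [] (Sim (tm_start M)) st4"
  proof (rule leads_to_edge[of _ "[pop (left_sym B), push (left_sym B)]"])
    have "exec_op (pop (left_sym B)) st4 = Some (st4(False := ?l))"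
      unfolding exec_op_pop by (simp add: st4_def)
    then show "exec_ops [pop (left_sym B), push (left_sym B)] st4 = Some st4"
      by (auto simp: st4_def)
  qed (simp_all add: control_edges_def)
  have "leads_to Load (\<lambda>_. []) v (Sim (tm_start M)) st4"
    using leads_to_trans[OF 0 leads_to_trans[OF 1 leads_to_trans[OF 2 leads_to_trans[OF 3
      leads_to_trans[OF 4 5]]]]] by simp
  moreover have "encodes st4 (tm_initial M (map Inl v)) (Suc l) (length v + Suc r)"
    by (rule encodes_initial) (simp_all add: st4_def)
  ultimately show ?thesis by auto
qed

text \<open>A move costs at most one cell on either side: a right move takes one from the right
  stack, a left move one from the left stack.\<close>

lemma leads_to_step:
  assumes "tm_step M c c'" and wf: "wf_config c" and enc: "encodes st c (Suc l) (Suc r)"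
  shows "\<exists>st' l' r'. l \<le> l' \<and> r \<le> r' \<and> encodes st' c' l' r' \<and>
    leads_to (Sim (fst c)) st [] (Sim (fst c')) st'"
  using assms(1)
proof cases
  case (1 q tape i q' y d)
  have q: "q \<in> tm_states M" and tape: "tape j \<in> \<Gamma>" for j using wf 1 by auto
  have st: "st True = right_sym (tape i) # map right_sym (right_cells tape (i + 1) r)"
    "st False = left_sym (tape (i - 1)) # map left_sym (left_cells tape (i - 1) l)"
    "st False = map left_sym (left_cells tape i (Suc l))"
    using enc 1 by (simp_all add: right_cells_Suc left_cells_Suc)
  have pop_right: "exec_op (pop (right_sym (tape i))) st =
    Some (st(True := map right_sym (right_cells tape (i + 1) r)))"
    unfolding exec_op_pop using st by simp
  have step_edges: "step_edges q (tape i) \<subseteq> control_edges"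
    using q tape unfolding control_edges_def by blast
  show ?thesis
  proof (cases d)
    case Right
    let ?st = "st(True := map right_sym (right_cells tape (i + 1) r), False := left_sym y # st False)"
    have "leads_to (Sim q) st [] (Sim q') ?st"
    proof (rule leads_to_edge)
      show "(Sim q, [pop (right_sym (tape i)), push (left_sym y)], Sim q') \<in> control_edges"
        by (rule subsetD[OF step_edges]) (use 1 Right in \<open>simp add: step_edges_def\<close>)
    qed (use pop_right in simp_all)
    moreover have "encodes ?st c' (Suc (Suc l)) r"
      using 1 Right st(3) left_cells_upd[of i i tape y "Suc l"]
      by (simp add: left_cells_Suc[of _ "i + 1"] right_cells_upd)
    ultimately show ?thesis using 1 by (metis fst_conv le_SucI order_refl)
  next
    case Left
    let ?x = "tape (i - 1)"
    let ?st = "st(True := right_sym ?x # right_sym y # map right_sym (right_cells tape (i + 1) r),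
      False := map left_sym (left_cells tape (i - 1) l))"
    have "leads_to (Sim q) st [] (Sim q') ?st"
    proof (rule leads_to_edge)
      show "(Sim q, [pop (right_sym (tape i)), push (right_sym y), pop (left_sym ?x),
          push (right_sym ?x)], Sim q') \<in> control_edges"
        by (rule subsetD[OF step_edges]) (use 1 Left tape in \<open>auto simp: step_edges_def\<close>)
      have "exec_op (pop (left_sym ?x))
          (st(True := right_sym y # map right_sym (right_cells tape (i + 1) r))) =
        Some (st(True := right_sym y # map right_sym (right_cells tape (i + 1) r),
          False := map left_sym (left_cells tape (i - 1) l)))"
        unfolding exec_op_pop using st(2) by simp
      then show "exec_ops [pop (right_sym (tape i)), push (right_sym y), pop (left_sym ?x),
          push (right_sym ?x)] st = Some ?st"
        using pop_right by (auto simp: fun_upd_twist)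
    qed simp
    moreover have "encodes ?st c' l (Suc (Suc r))"
      using 1 Left by (simp add: right_cells_Suc right_cells_upd left_cells_upd)
    ultimately show ?thesis using 1 by (metis fst_conv le_SucI order_refl)
  qed
qed

text \<open>One cell per side and per step is budget enough. The bound \<open>k\<close> depends on
  the computation but not on the stacks, so the blanks can be guessed to fit it.\<close>

lemma leads_to_steps:
  assumes "(tm_step M)\<^sup>*\<^sup>* c c'" and "wf_config c"
  shows "\<exists>k. \<forall>l \<ge> k. \<forall>r \<ge> k. \<forall>st. encodes st c l r \<longrightarrow>
    (\<exists>st'. leads_to (Sim (fst c)) st [] (Sim (fst c')) st')"
  using assms
proof (induction rule: converse_rtranclp_induct)
  case base
  show ?case using leads_to_refl by blast
next
  case (step c c1)
  then obtain k where k: "\<And>l r st. \<lbrakk>k \<le> l; k \<le> r; encodes st c1 l r\<rbrakk> \<Longrightarrow>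
      \<exists>st'. leads_to (Sim (fst c1)) st [] (Sim (fst c')) st'"
    using wf_config_step by blast
  have "\<exists>st'. leads_to (Sim (fst c)) st [] (Sim (fst c')) st'"
    if kl: "Suc k \<le> l" "Suc k \<le> r" and enc: "encodes st c l r" for l r st
  proof -
    obtain l0 r0 where lr: "l = Suc l0" "r = Suc r0" using kl by (meson Suc_le_D)
    with enc leads_to_step[OF step.hyps(1) step.prems, of st l0 r0] obtain st1 l1 r1 where
      1: "l0 \<le> l1" "r0 \<le> r1" "encodes st1 c1 l1 r1"
        "leads_to (Sim (fst c)) st [] (Sim (fst c1)) st1" by blast
    then obtain st' where "leads_to (Sim (fst c1)) st1 [] (Sim (fst c')) st'"
      using k[of l1 r1 st1] kl lr by auto
    with leads_to_trans[OF 1(4)] show ?thesis by force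
  qed
  then show ?case by blast
qed

lemma simulation_complete:
  assumes "v \<in> lists \<Sigma>" and "tm_accepts M (map Inl v)"
  shows "\<exists>u. \<exists>q \<in> tm_accept M. word_path control_edges Load u (Sim q) \<and>
    exec_ops u (\<lambda>_. []) \<noteq> None \<and> output_word u = v"
proof -
  obtain q tape i where steps: "(tm_step M)\<^sup>*\<^sup>* (tm_initial M (map Inl v)) (q, tape, i)"
    and q: "q \<in> tm_accept M" using assms(2) by (auto simp: tm_accepts_def)
  have start: "fst (tm_initial M w) = tm_start M" for w by (simp add: tm_initial_def)
  obtain k where k: "\<And>l r st. \<lbrakk>k \<le> l; k \<le> r; encodes st (tm_initial M (map Inl v)) l r\<rbrakk> \<Longrightarrow>
      \<exists>st'. leads_to (Sim (tm_start M)) st [] (Sim q) st'"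
    using leads_to_steps[OF steps wf_config_initial[OF assms(1)], unfolded start fst_conv] by blast
  \<comment> \<open>Guessing \<open>k\<close> blanks for each side makes both extents of the window
    at least \<open>k\<close>.\<close>
  obtain st where st: "leads_to Load (\<lambda>_. []) v (Sim (tm_start M)) st"
    "encodes st (tm_initial M (map Inl v)) (Suc k) (length v + Suc k)"
    using leads_to_initial[OF assms(1)] by blast
  obtain st' where "leads_to (Sim (tm_start M)) st [] (Sim q) st'"
    using k[OF _ _ st(2)] by auto
  from leads_to_trans[OF st(1) this] show ?thesis using q by (auto simp: leads_to_def)
qed

section \<open>Assembling the representation\<close>

lemma tm_lang_representation:
  assumes L: "L \<subseteq> lists \<Sigma>" "map Inl ` L = tm_lang M"
  defines "A \<equiv> {..<2 * (4 * n)}"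
  shows "\<exists>L' R h. rpn_coverability_language A L' \<and> regular_language A R \<and>
    word_homomorphism A \<Sigma> h \<and> L = h ` (L' \<inter> R)"
proof (intro exI conjI)
  let ?L = "{u \<in> lists A. exec_ops u (\<lambda>_. []) \<noteq> None}"
  let ?R = "{u. \<exists>q \<in> Sim ` tm_accept M. word_path control_edges Load u q}"
  show "rpn_coverability_language A ?L" unfolding A_def by (rule stack_language)
  have "finite (tm_accept M)" using tm by (auto simp: is_tm_def intro: finite_subset)
  then show "regular_language A ?R"
    using control_edges_alphabet finite_control_edges
    by (intro regular_language_word_path) (auto simp: A_def)
  have "output_word u \<in> lists \<Sigma>" for u
    using letter_in by (induction u) (auto simp: lists_eq_set)
  then show "word_homomorphism A \<Sigma> output_word" by (auto simp: word_homomorphism_def)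
  have alphabet: "u \<in> lists A" if "word_path control_edges p u q" for p u q
    using that by induction (use control_edges_alphabet in \<open>auto simp: A_def\<close>)
  have Inl_L: "v \<in> L" if "map Inl v \<in> tm_lang M" for v
    using that L(2)[symmetric] by auto
  show "L = output_word ` (?L \<inter> ?R)"
  proof (intro equalityI subsetI)
    fix v assume "v \<in> L"
    with L have "v \<in> lists \<Sigma>" "map Inl v \<in> tm_lang M" by auto
    then obtain u q where "q \<in> tm_accept M" "word_path control_edges Load u (Sim q)"
      "exec_ops u (\<lambda>_. []) \<noteq> None" "output_word u = v"
      using simulation_complete by (fastforce simp: tm_lang_def)
    then show "v \<in> output_word ` (?L \<inter> ?R)" using alphabet by blast
  next
    fix v assume "v \<in> output_word ` (?L \<inter> ?R)"
    then show "v \<in> L" using simulation_sound Inl_L by blast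
  qed
qed

end

theorem theorem2:
  fixes \<Sigma> :: "'a set" and L :: "'a list set"
  assumes "finite \<Sigma>"
    and "recursively_enumerable \<Sigma> L"
  shows "\<exists>(A :: nat set) L' R h.
    rpn_coverability_language A L' \<and> regular_language A R \<and>
    word_homomorphism A \<Sigma> h \<and> L = h ` (L' \<inter> R)"
proof -
  obtain M :: "(nat, 'a + nat) tm" where L: "L \<subseteq> lists \<Sigma>" "map Inl ` L = tm_lang M"
    and M: "is_tm M" "tm_input M = Inl ` \<Sigma>"
    using assms(2) unfolding recursively_enumerable_def by blast
  have "finite (tm_tape M)" using M by (simp add: is_tm_def)
  \<comment> \<open>The codes fill an initial segment of the naturals, which supplies the bound
    \<open>n\<close> on which the alphabet size rests.\<close>
  then obtain code :: "'a + nat \<Rightarrow> nat" and n where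
    code: "code ` tm_tape M = {i. i < n}" "inj_on code (tm_tape M)"
    using finite_imp_inj_to_nat_seg by blast
  interpret tm_simulation M \<Sigma> code n
    by standard (use M code in auto)
  show ?thesis using tm_lang_representation[OF L] by blast
qed

end
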